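(* Let $0<m<\infty$ and let $(M,g)$ be a connected, oriented, complete, non-compact Riemannian manifold admitting an $m$-modified gradient conformal vector field $\nabla f$, i.e. $f$ is a smooth function on $M$ satisfying $\mathrm{Hess} f-\frac1m df\otimes df=\sigma g$ for some smooth function $\sigma$ on $M$. Put $u=e^{-f/m}$. Suppose that the Ricci curvature satisfies $\mathrm{Ric}\le -\alpha g$ for some positive constant $\alpha$, that $M$ has polynomial volume growth, and that $|\nabla u|,\ |\nabla\nabla u|\in L^\infty(M)$. Then $f$ is constant.
   Context: $\mathrm{Hess}$ is the Hessian with respect to $g$, $\nabla f$ is the gradient of $f$, $\mathrm{Ric}$ is the Ricci tensor, and $\nabla\nabla u$ is the covariant derivative of $\nabla u$ (so $|\nabla\nabla u|=|\mathrm{Hess}\,u|$), norms being those induced by $g$. For $0<m<\infty$, an $m$-modified gradient conformal vector field is a gradient field $\nabla f$ with $\mathrm{Hess} f-\frac1m df\otimes df=\sigma g$ for some smooth function $\sigma$. $M$ has polynomial volume growth if there exist a polynomial function $P:(0,\infty)\to(0,\infty)$ and a point $p\in M$ such that $\mathrm{Vol}(B(p,r))=\mathcal{O}(P(r))$ as $r\to\infty$, where $B(p,r)$ is the geodesic ball of radius $r$ centered at $p$ and $\mathrm{Vol}$ is the volume of $g$. *)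

theory Defs
  imports "HOL-Analysis.Analysis" "HOL-Computational_Algebra.Polynomial"
begin

section \<open>Smooth maps between open subsets of Euclidean spaces\<close>

primrec Ck_on ::
  "nat \<Rightarrow> 'a::euclidean_space set \<Rightarrow> ('a \<Rightarrow> 'b::real_normed_vector) \<Rightarrow> bool" where
  "Ck_on 0 S f \<longleftrightarrow> continuous_on S f"
| "Ck_on (Suc k) S f \<longleftrightarrow>
     (\<forall>x\<in>S. f differentiable (at x)) \<and> (\<forall>v. Ck_on k S (\<lambda>x. frechet_derivative f (at x) v))"

text \<open>Only used on open sets, where the unrestricted derivatives depend on the values of the
  function on that set alone.\<close>

definition smooth_on :: "'a::euclidean_space set \<Rightarrow> ('a \<Rightarrow> 'b::real_normed_vector) \<Rightarrow> bool" where
  "smooth_on S f \<longleftrightarrow> (\<forall>k. Ck_on k S f)"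

definition pd :: "'n::finite \<Rightarrow> (real^'n \<Rightarrow> real) \<Rightarrow> real^'n \<Rightarrow> real" where
  "pd i F x = frechet_derivative F (at x) (axis i 1)"


section \<open>Riemannian geometry in one coordinate chart\<close>

text \<open>Here \<^term>\<open>g :: real^'n \<Rightarrow> real^'n^'n\<close> is the matrix of the metric in the chart, and functions and
  tensors are given by their components with respect to the coordinate frame.\<close>

definition metric_norm :: "real^'n^'n \<Rightarrow> real^'n \<Rightarrow> real" where
  "metric_norm h v = sqrt (v \<bullet> (h *v v))"

definition christoffel ::
  "(real^'n \<Rightarrow> real^'n^'n) \<Rightarrow> 'n::finite \<Rightarrow> 'n \<Rightarrow> 'n \<Rightarrow> real^'n \<Rightarrow> real" where
  "christoffel g k i j x =
     (1/2) * (\<Sum>l\<in>UNIV. matrix_inv (g x) $ k $ l *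
        (pd i (\<lambda>y. g y $ j $ l) x + pd j (\<lambda>y. g y $ i $ l) x - pd l (\<lambda>y. g y $ i $ j) x))"

text \<open>\<open>curvature g l i j k\<close> is the component of index \<open>l\<close> of \<open>R(\<partial>\<^sub>i,\<partial>\<^sub>j)\<partial>\<^sub>k\<close>, with the convention
  \<open>R(X,Y) = [\<nabla>\<^sub>X,\<nabla>\<^sub>Y] - \<nabla>\<^bsub>[X,Y]\<^esub>\<close>.  The Ricci tensor is the trace of \<open>X \<mapsto> R(X,Y)Z\<close>, so that it is
  positive on round spheres.\<close>

definition curvature ::
  "(real^'n \<Rightarrow> real^'n^'n) \<Rightarrow> 'n::finite \<Rightarrow> 'n \<Rightarrow> 'n \<Rightarrow> 'n \<Rightarrow> real^'n \<Rightarrow> real" where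
  "curvature g l i j k x =
     pd i (christoffel g l j k) x - pd j (christoffel g l i k) x
     + (\<Sum>h\<in>UNIV. christoffel g l i h x * christoffel g h j k x
                 - christoffel g l j h x * christoffel g h i k x)"

definition ricci :: "(real^'n \<Rightarrow> real^'n^'n) \<Rightarrow> real^'n \<Rightarrow> real^'n^'n" where
  "ricci g x = (\<chi> j k. \<Sum>i\<in>UNIV. curvature g i i j k x)"

definition differential :: "(real^'n \<Rightarrow> real) \<Rightarrow> real^'n \<Rightarrow> real^'n" where
  "differential F x = (\<chi> i. pd i F x)"

definition gradient :: "(real^'n \<Rightarrow> real^'n^'n) \<Rightarrow> (real^'n \<Rightarrow> real) \<Rightarrow> real^'n \<Rightarrow> real^'n" where
  "gradient g F x = matrix_inv (g x) *v differential F x"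

definition hessian :: "(real^'n \<Rightarrow> real^'n^'n) \<Rightarrow> (real^'n \<Rightarrow> real) \<Rightarrow> real^'n \<Rightarrow> real^'n^'n" where
  "hessian g F x =
     (\<chi> i j. pd i (pd j F) x - (\<Sum>k\<in>UNIV. christoffel g k i j x * pd k F x))"

text \<open>The covariant derivative of a vector field is the (1,1)-tensor whose entry \<open>$ i $ j\<close> is the
  component of index \<open>i\<close> of \<open>\<nabla>\<^bsub>\<partial>\<^sub>j\<^esub> X\<close>.\<close>

definition cov_deriv ::
  "(real^'n \<Rightarrow> real^'n^'n) \<Rightarrow> (real^'n \<Rightarrow> real^'n) \<Rightarrow> real^'n \<Rightarrow> real^'n^'n" where
  "cov_deriv g X x =
     (\<chi> i j. pd j (\<lambda>y. X y $ i) x + (\<Sum>k\<in>UNIV. christoffel g i j k x * X x $ k))"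

definition metric_norm11 :: "real^'n^'n \<Rightarrow> real^'n^'n \<Rightarrow> real" where
  "metric_norm11 h T =
     sqrt (\<Sum>i\<in>UNIV. \<Sum>k\<in>UNIV. \<Sum>j\<in>UNIV. \<Sum>l\<in>UNIV.
             h $ i $ k * matrix_inv h $ j $ l * T $ i $ j * T $ k $ l)"


section \<open>Smooth manifolds and Riemannian metrics\<close>

text \<open>A chart is a pair of its domain and its coordinate map.\<close>

type_synonym ('a, 'n) chart = "'a set \<times> ('a \<Rightarrow> real^'n)"

definition cinv :: "('a, 'n::finite) chart \<Rightarrow> real^'n \<Rightarrow> 'a" where
  "cinv c = the_inv_into (fst c) (snd c)"

definition cimg :: "('a, 'n::finite) chart \<Rightarrow> (real^'n) set" where
  "cimg c = snd c ` fst c"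

definition jacobian_at :: "('a, 'n::finite) chart \<Rightarrow> ('a, 'n) chart \<Rightarrow> 'a \<Rightarrow> real^'n^'n" where
  "jacobian_at c d p = matrix (frechet_derivative (snd d \<circ> cinv c) (at (snd c p)))"

definition smooth_atlas :: "'a topology \<Rightarrow> ('a, 'n::finite) chart set \<Rightarrow> bool" where
  "smooth_atlas X A \<longleftrightarrow>
     (\<forall>c\<in>A. openin X (fst c) \<and> open (cimg c) \<and>
        homeomorphic_map (subtopology X (fst c)) (top_of_set (cimg c)) (snd c)) \<and>
     (\<Union>c\<in>A. fst c) = topspace X \<and>
     (\<forall>c\<in>A. \<forall>d\<in>A. smooth_on (snd c ` (fst c \<inter> fst d)) (snd d \<circ> cinv c))"

text \<open>The metric is given by its matrix in every chart of the atlas, as a function on the image of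
  the chart.\<close>

record ('a, 'n) riem =
  mtop :: "'a topology"
  atlas :: "('a, 'n::finite) chart set"
  gmat :: "('a, 'n) chart \<Rightarrow> real^'n \<Rightarrow> real^'n^'n"

definition riemannian_metric ::
  "('a, 'n::finite) chart set \<Rightarrow> (('a, 'n) chart \<Rightarrow> real^'n \<Rightarrow> real^'n^'n) \<Rightarrow> bool" where
  "riemannian_metric A G \<longleftrightarrow>
     (\<forall>c\<in>A. smooth_on (cimg c) (G c)) \<and>
     (\<forall>c\<in>A. \<forall>x\<in>cimg c. transpose (G c x) = G c x \<and> (\<forall>v. v \<noteq> 0 \<longrightarrow> v \<bullet> (G c x *v v) > 0)) \<and>
     (\<forall>c\<in>A. \<forall>d\<in>A. \<forall>p\<in>fst c \<inter> fst d.
        G c (snd c p) =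
          transpose (jacobian_at c d p) ** G d (snd d p) ** jacobian_at c d p)"

definition riemannian_manifold :: "('a, 'n::finite) riem \<Rightarrow> bool" where
  "riemannian_manifold M \<longleftrightarrow>
     Hausdorff_space (mtop M) \<and> second_countable (mtop M) \<and>
     smooth_atlas (mtop M) (atlas M) \<and> riemannian_metric (atlas M) (gmat M)"

text \<open>An orientation is given by an atlas of the same smooth structure (its charts are smoothly
  compatible with those of \<^term>\<open>atlas M\<close>) whose transition maps preserve orientation.\<close>

definition orientation :: "('a, 'n::finite) riem \<Rightarrow> ('a, 'n) chart set \<Rightarrow> bool" where
  "orientation M B \<longleftrightarrow>
     smooth_atlas (mtop M) B \<and> smooth_atlas (mtop M) (atlas M \<union> B) \<and>
     (\<forall>c\<in>B. \<forall>d\<in>B. \<forall>p\<in>fst c \<inter> fst d. det (jacobian_at c d p) > 0)"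

definition smooth_function :: "('a, 'n::finite) riem \<Rightarrow> ('a \<Rightarrow> real) \<Rightarrow> bool" where
  "smooth_function M f \<longleftrightarrow> (\<forall>c\<in>atlas M. smooth_on (cimg c) (f \<circ> cinv c))"

text \<open>Scalar quantities are evaluated at a point in an arbitrarily chosen chart around it; those
  below do not depend on the choice.\<close>

definition chart_at :: "('a, 'n::finite) riem \<Rightarrow> 'a \<Rightarrow> ('a, 'n) chart" where
  "chart_at M p = (SOME c. c \<in> atlas M \<and> p \<in> fst c)"

definition norm_grad :: "('a, 'n::finite) riem \<Rightarrow> ('a \<Rightarrow> real) \<Rightarrow> 'a \<Rightarrow> real" where
  "norm_grad M u p =
     (let c = chart_at M p; x = snd c p
      in metric_norm (gmat M c x) (gradient (gmat M c) (u \<circ> cinv c) x))"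

definition norm_cov_grad :: "('a, 'n::finite) riem \<Rightarrow> ('a \<Rightarrow> real) \<Rightarrow> 'a \<Rightarrow> real" where
  "norm_cov_grad M u p =
     (let c = chart_at M p; x = snd c p
      in metric_norm11 (gmat M c x) (cov_deriv (gmat M c) (gradient (gmat M c) (u \<circ> cinv c)) x))"


section \<open>Distance, geodesics, volume\<close>

text \<open>\<open>piecewise_C1_differentiable_on\<close> does not ask for one-sided derivatives at the break points.
  This admits a few more curves than the usual notion, without changing the infimum of lengths.\<close>

definition pw_C1_curve :: "('a, 'n::finite) riem \<Rightarrow> (real \<Rightarrow> 'a) \<Rightarrow> bool" where
  "pw_C1_curve M \<gamma> \<longleftrightarrow>
     continuous_map (top_of_set {0..1}) (mtop M) \<gamma> \<and>
     (\<forall>c\<in>atlas M. \<forall>a b. 0 \<le> a \<and> a < b \<and> b \<le> 1 \<and> \<gamma> ` {a..b} \<subseteq> fst c \<longrightarrow>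
        (snd c \<circ> \<gamma>) piecewise_C1_differentiable_on {a..b})"

definition speed :: "('a, 'n::finite) riem \<Rightarrow> (real \<Rightarrow> 'a) \<Rightarrow> real \<Rightarrow> real" where
  "speed M \<gamma> t =
     (let c = chart_at M (\<gamma> t)
      in metric_norm (gmat M c (snd c (\<gamma> t))) (vector_derivative (snd c \<circ> \<gamma>) (at t)))"

definition curve_length :: "('a, 'n::finite) riem \<Rightarrow> (real \<Rightarrow> 'a) \<Rightarrow> ennreal" where
  "curve_length M \<gamma> = (\<integral>\<^sup>+ t\<in>{0..1}. ennreal (speed M \<gamma> t) \<partial>lborel)"

definition riem_dist :: "('a, 'n::finite) riem \<Rightarrow> 'a \<Rightarrow> 'a \<Rightarrow> ennreal" where
  "riem_dist M p q = (INF \<gamma>\<in>{\<gamma>. pw_C1_curve M \<gamma> \<and> \<gamma> 0 = p \<and> \<gamma> 1 = q}. curve_length M \<gamma>)"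

definition geodesic_ball :: "('a, 'n::finite) riem \<Rightarrow> 'a \<Rightarrow> real \<Rightarrow> 'a set" where
  "geodesic_ball M p r = {q \<in> topspace (mtop M). riem_dist M p q < ennreal r}"

definition geodesic_line :: "('a, 'n::finite) riem \<Rightarrow> (real \<Rightarrow> 'a) \<Rightarrow> bool" where
  "geodesic_line M \<gamma> \<longleftrightarrow>
     continuous_map euclideanreal (mtop M) \<gamma> \<and>
     (\<forall>c\<in>atlas M. \<forall>t. \<gamma> t \<in> fst c \<longrightarrow>
        (let x = snd c \<circ> \<gamma>; v = (\<lambda>s. vector_derivative x (at s))
         in x differentiable (at t) \<and>
            (v has_vector_derivative
               (\<chi> k. - (\<Sum>i\<in>UNIV. \<Sum>j\<in>UNIV.
                           christoffel (gmat M c) k i j (x t) * v t $ i * v t $ j))) (at t)))"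

text \<open>Completeness is geodesic completeness: the exponential map is defined on the whole tangent
  bundle.  The tangent vector is given by its components \<open>v\<close> in a chart \<open>c\<close> around \<open>p\<close>.\<close>

definition complete_riem :: "('a, 'n::finite) riem \<Rightarrow> bool" where
  "complete_riem M \<longleftrightarrow>
     (\<forall>c\<in>atlas M. \<forall>p\<in>fst c. \<forall>v. \<exists>\<gamma>.
        geodesic_line M \<gamma> \<and> \<gamma> 0 = p \<and> vector_derivative (snd c \<circ> \<gamma>) (at 0) = v)"

text \<open>\<open>chart_volume M c\<close> is the Borel measure on \<open>M\<close> that is concentrated on the domain of the chart
  \<open>c\<close> and has density \<open>sqrt (det g)\<close> in its coordinates.  By the change of variables formula these
  measures agree on overlaps, so their supremum is the unique Borel measure on \<open>M\<close> that restricts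
  to each of them, i.e. the volume of the metric.\<close>

definition chart_volume :: "('a, 'n::finite) riem \<Rightarrow> ('a, 'n) chart \<Rightarrow> 'a measure" where
  "chart_volume M c =
     distr (density (restrict_space lborel (cimg c)) (\<lambda>x. ennreal (sqrt (det (gmat M c x)))))
           (sigma (topspace (mtop M)) {U. openin (mtop M) U}) (cinv c)"

definition riem_volume :: "('a, 'n::finite) riem \<Rightarrow> 'a measure" where
  "riem_volume M = (SUP c\<in>atlas M. chart_volume M c)"

text \<open>The ball may a priori have infinite volume; the bound below makes it finite for large \<open>r\<close>.\<close>

definition polynomial_volume_growth :: "('a, 'n::finite) riem \<Rightarrow> bool" where
  "polynomial_volume_growth M \<longleftrightarrow>
     (\<exists>(P :: real poly) p. (\<forall>r>0. poly P r > 0) \<and> p \<in> topspace (mtop M) \<and>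
        (\<exists>C. \<forall>\<^sub>F r in at_top.
           emeasure (riem_volume M) (geodesic_ball M p r) \<le> ennreal (C * poly P r)))"

definition L_infinity :: "'a measure \<Rightarrow> ('a \<Rightarrow> real) set" where
  "L_infinity \<mu> = {h \<in> borel_measurable \<mu>. \<exists>C. AE p in \<mu>. \<bar>h p\<bar> \<le> C}"


section \<open>Curvature bounds and modified conformal gradient fields\<close>

definition ricci_le :: "('a, 'n::finite) riem \<Rightarrow> real \<Rightarrow> bool" where
  "ricci_le M \<kappa> \<longleftrightarrow>
     (\<forall>c\<in>atlas M. \<forall>x\<in>cimg c. \<forall>v.
        v \<bullet> (ricci (gmat M c) x *v v) \<le> \<kappa> * (v \<bullet> (gmat M c x *v v)))"

definition modified_gradient_conformal ::
  "('a, 'n::finite) riem \<Rightarrow> real \<Rightarrow> ('a \<Rightarrow> real) \<Rightarrow> bool" where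
  "modified_gradient_conformal M m f \<longleftrightarrow>
     smooth_function M f \<and>
     (\<exists>\<sigma>. smooth_function M \<sigma> \<and>
        (\<forall>c\<in>atlas M. \<forall>x\<in>cimg c. \<forall>i j.
           hessian (gmat M c) (f \<circ> cinv c) x $ i $ j
             - (1/m) * (differential (f \<circ> cinv c) x $ i * differential (f \<circ> cinv c) x $ j)
           = \<sigma> (cinv c x) * gmat M c x $ i $ j))"

end

theory Submission
  imports Defs
begin

text \<open>
  With \<open>u = exp (- f / m)\<close> the hypothesis becomes \<open>Hess u = \<psi> g\<close>, i.e. \<open>\<nabla>\<^bsub>X\<^esub> V = \<psi> X\<close> for
  \<open>V = \<nabla>u\<close>; commuting covariant derivatives gives \<open>Ric V = - (n - 1) \<nabla>\<psi>\<close>.  Suppose that \<open>V\<close> does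
  not vanish at \<open>p\<close>, and let \<open>\<gamma>\<close> be the geodesic with \<open>\<gamma>' (0) = V p\<close>.  Then \<open>e = |\<gamma>'|\<^sup>2\<close> is
  constant, and the Cauchy--Schwarz defect \<open>|V|\<^sup>2 e - w\<^sup>2\<close> of \<open>V\<close> and \<open>\<gamma>'\<close>, where
  \<open>w = \<langle>V, \<gamma>'\<rangle>\<close>, has derivative zero along \<open>\<gamma>\<close>, so that \<open>V = (w / e) \<gamma>'\<close>
  on the whole line.  As \<open>w' = e \<psi>\<close>, the Ricci bound yields \<open>(n - 1) w'' w \<ge> \<alpha> e w\<^sup>2\<close>; hence \<open>w\<^sup>2\<close>
  is convex, and it is bounded because \<open>|V|\<close> is.  So \<open>w\<close> vanishes, contradicting \<open>w 0 = |V p|\<^sup>2\<close>.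
\<close>

section \<open>Partial derivatives\<close>

lemma pd_eqI: "(F has_derivative D) (at x) \<Longrightarrow> pd i F x = D (axis i 1)"
  unfolding pd_def by (metis frechet_derivative_at)

lemma frechet_derivative_cong_on:
  assumes "open S" "x \<in> S" "\<And>y. y \<in> S \<Longrightarrow> F y = G y"
  shows "frechet_derivative F (at x) = frechet_derivative G (at x)"
proof -
  \<comment> \<open>\<open>frechet_derivative\<close> is a choice from the set of derivatives, so
    equality of these sets is enough; differentiability at \<open>x\<close> is not involved.\<close>
  have "(F has_derivative D) (at x) \<longleftrightarrow> (G has_derivative D) (at x)" for D
    using has_derivative_transform_within_open[of F D x UNIV S G]
      has_derivative_transform_within_open[of G D x UNIV S F] assms by auto
  then show ?thesis by (simp add: frechet_derivative_def)
qed

lemma pd_cong_on: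
  assumes "open S" "x \<in> S" "\<And>y. y \<in> S \<Longrightarrow> F y = G y"
  shows "pd i F x = pd i G x"
  using frechet_derivative_cong_on[OF assms] by (simp add: pd_def)

lemma differentiable_cong_on:
  assumes "open S" "x \<in> S" "\<And>y. y \<in> S \<Longrightarrow> F y = G y" "F differentiable (at x)"
  shows "G differentiable (at x)"
  using assms has_derivative_transform_within_open[of F _ x UNIV S G]
  unfolding differentiable_def by blast

lemma pd_const [simp]: "pd i (\<lambda>y. c) x = 0"
  by (rule pd_eqI[of _ "\<lambda>_. 0", simplified]) simp

lemma pd_diff:
  assumes "F differentiable (at x)" "G differentiable (at x)"
  shows "pd i (\<lambda>y. F y - G y) x = pd i F x - pd i G x"
proof -
  have "((\<lambda>y. F y - G y) has_derivative
      (\<lambda>h. frechet_derivative F (at x) h - frechet_derivative G (at x) h)) (at x)"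
    using assms by (intro has_derivative_diff) (auto simp: frechet_derivative_works)
  from pd_eqI[OF this] show ?thesis by (simp add: pd_def)
qed

lemma pd_mult:
  assumes "F differentiable (at x)" "G differentiable (at x)"
  shows "pd i (\<lambda>y. F y * G y) x = F x * pd i G x + pd i F x * G x"
proof -
  have "((\<lambda>y. F y * G y) has_derivative
      (\<lambda>h. F x * frechet_derivative G (at x) h + frechet_derivative F (at x) h * G x)) (at x)"
    using assms by (intro has_derivative_mult) (auto simp: frechet_derivative_works)
  from pd_eqI[OF this] show ?thesis by (simp add: pd_def)
qed

lemma pd_sum:
  assumes "\<And>k. k \<in> K \<Longrightarrow> F k differentiable (at x)"
  shows "pd i (\<lambda>y. \<Sum>k\<in>K. F k y) x = (\<Sum>k\<in>K. pd i (F k) x)"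
proof -
  have "((\<lambda>y. \<Sum>k\<in>K. F k y) has_derivative
      (\<lambda>h. \<Sum>k\<in>K. frechet_derivative (F k) (at x) h)) (at x)"
    using assms by (intro has_derivative_sum) (auto simp: frechet_derivative_works)
  from pd_eqI[OF this] show ?thesis by (simp add: pd_def)
qed

lemma differentiable_sumI:
  assumes "finite K" "\<And>k. k \<in> K \<Longrightarrow> F k differentiable net"
  shows "(\<lambda>y. \<Sum>k\<in>K. F k y) differentiable net"
  using assms by (intro differentiable_sum) auto

lemma differentiable_prodI:
  fixes f :: "'i \<Rightarrow> 'c::real_normed_vector \<Rightarrow> real"
  assumes "\<And>i. i \<in> I \<Longrightarrow> f i differentiable (at x)"
  shows "(\<lambda>y. \<Prod>i\<in>I. f i y) differentiable (at x)"
  using assms by (induction I rule: infinite_finite_induct) auto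

lemma det_differentiable:
  fixes A :: "'c::real_normed_vector \<Rightarrow> real^'n::finite^'n"
  assumes "\<And>i j. (\<lambda>y. A y $ i $ j) differentiable (at x)"
  shows "(\<lambda>y. det (A y)) differentiable (at x)"
  unfolding det_def
  by (intro differentiable_sumI differentiable_mult differentiable_prodI assms) auto

lemma sum_axis: "(\<Sum>k\<in>UNIV. axis i 1 $ k * (c k :: real)) = c (i :: 'n::finite)"
proof -
  have "(\<Sum>k\<in>UNIV. axis i 1 $ k * c k) = (\<Sum>k\<in>UNIV. if k = i then c k else 0)"
    by (rule sum.cong) (auto simp: axis_def)
  then show ?thesis by simp
qed

lemma frechet_derivative_eq_sum_pd:
  fixes F :: "real^'n::finite \<Rightarrow> real"
  assumes "F differentiable (at x)"
  shows "frechet_derivative F (at x) v = (\<Sum>i\<in>UNIV. v $ i * pd i F x)"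
proof -
  have lin: "linear (frechet_derivative F (at x))"
    using assms linear_frechet_derivative by blast
  have "frechet_derivative F (at x) v
      = frechet_derivative F (at x) (\<Sum>i\<in>UNIV. v $ i *\<^sub>R axis i 1)"
    by (simp add: basis_expansion flip: scalar_mult_eq_scaleR)
  also have "\<dots> = (\<Sum>i\<in>UNIV. v $ i * pd i F x)"
    by (simp add: linear_sum[OF lin] linear_scale[OF lin] pd_def)
  finally show ?thesis .
qed

lemma has_real_derivative_along_curve:
  fixes F :: "real^'n::finite \<Rightarrow> real"
  assumes "(\<xi> has_vector_derivative v) (at t)" "F differentiable (at (\<xi> t))"
  shows "((\<lambda>s. F (\<xi> s)) has_real_derivative (\<Sum>i\<in>UNIV. v $ i * pd i F (\<xi> t))) (at t)"
proof -
  have "(F has_derivative frechet_derivative F (at (\<xi> t))) (at (\<xi> t))"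
    using assms(2) frechet_derivative_works by blast
  then have "((\<lambda>s. F (\<xi> s)) has_derivative
      (\<lambda>h. frechet_derivative F (at (\<xi> t)) (h *\<^sub>R v))) (at t)"
    using assms(1) unfolding has_vector_derivative_def
    by (metis (no_types) has_derivative_compose)
  moreover have "frechet_derivative F (at (\<xi> t)) (h *\<^sub>R v)
      = h * (\<Sum>i\<in>UNIV. v $ i * pd i F (\<xi> t))" for h
    by (simp add: frechet_derivative_eq_sum_pd[OF assms(2)] sum_distrib_left mult.assoc)
  ultimately have "((\<lambda>s. F (\<xi> s)) has_derivative
      (\<lambda>h. h * (\<Sum>i\<in>UNIV. v $ i * pd i F (\<xi> t)))) (at t)" by simp
  then show ?thesis
    by (simp add: has_field_derivative_def mult_commute_abs)
qed

section \<open>Derivatives of smooth functions and symmetry of second derivatives\<close>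

lemma smooth_onD_differentiable:
  "smooth_on S f \<Longrightarrow> x \<in> S \<Longrightarrow> f differentiable (at x)"
  unfolding smooth_on_def using Ck_on.simps(2) by blast

lemma smooth_onD_frechet_derivative:
  "smooth_on S f \<Longrightarrow> smooth_on S (\<lambda>x. frechet_derivative f (at x) v)"
  unfolding smooth_on_def using Ck_on.simps(2) by blast

text \<open>The mean value theorem in direction \<open>a\<close> turns the second difference into an
  increment of \<open>pd i F\<close>, which differentiability at the single point \<open>x\<close>
  evaluates to first order. The quotient is symmetric in \<open>a\<close> and \<open>b\<close> while
  the limit is written asymmetrically; this yields the symmetry of second derivatives.\<close>

lemma second_difference_quotient:
  fixes F :: "real^'n::finite \<Rightarrow> real" and i j :: 'n
  assumes S: "open S" "x \<in> S" and F: "\<And>y. y \<in> S \<Longrightarrow> F differentiable (at y)"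
    and Fi: "pd i F differentiable (at x)"
  defines "a \<equiv> axis i 1 :: real^'n" and "b \<equiv> axis j 1 :: real^'n"
  shows "((\<lambda>h. (F (x + h *\<^sub>R a + h *\<^sub>R b) - F (x + h *\<^sub>R a) - F (x + h *\<^sub>R b) + F x) / h^2)
           \<longlongrightarrow> pd j (pd i F) x) (at_right 0)"
proof (rule tendstoI)
  fix e :: real assume "e > 0"
  define D where "D = frechet_derivative (pd i F) (at x)"
  have D: "(pd i F has_derivative D) (at x)"
    using Fi frechet_derivative_works D_def by blast
  have lin: "linear D" using D has_derivative_linear by blast
  have na: "norm a = 1" "norm b = 1" by (simp_all add: a_def b_def norm_axis_1)
  \<comment> \<open>The increments to come have norms at most \<open>2 * h\<close> and
    \<open>h\<close>, so an error of \<open>e/4\<close> per unit length adds up to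
    \<open>3/4 * e * h\<close>, strictly below \<open>e * h\<close>.\<close>
  obtain d where d: "d > 0" and dD: "\<And>y. norm (y - x) < d \<Longrightarrow>
      norm (pd i F y - pd i F x - D (y - x)) \<le> e/4 * norm (y - x)"
    using D \<open>e > 0\<close> unfolding has_derivative_at_alt
    by (metis divide_pos_pos zero_less_numeral)
  obtain r where r: "r > 0" "ball x r \<subseteq> S"
    using S open_contains_ball by blast
  have main: "dist ((F (x + h *\<^sub>R a + h *\<^sub>R b) - F (x + h *\<^sub>R a) - F (x + h *\<^sub>R b) + F x) / h^2)
      (pd j (pd i F) x) < e" if h: "0 < h" "2 * h < min d r" for h
  proof -
    \<comment> \<open>\<open>k h - k 0\<close> is the second difference, and \<open>k\<close>
      depends on the step in direction \<open>a\<close> only.\<close>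
    define k where "k = (\<lambda>s. F (x + h *\<^sub>R b + s *\<^sub>R a) - F (x + s *\<^sub>R a))"
    have nb: "norm (c *\<^sub>R b + s *\<^sub>R a) \<le> c + s" if "0 \<le> s" "0 \<le> c" for s c :: real
      using norm_triangle_ineq[of "c *\<^sub>R b" "s *\<^sub>R a"] that na by simp
    have small: "x + c *\<^sub>R b + s *\<^sub>R a \<in> S" if "0 \<le> s" "s \<le> h" "0 \<le> c" "c \<le> h" for s c
    proof -
      have "dist x (x + c *\<^sub>R b + s *\<^sub>R a) < r"
        using nb[of s c] that h by (simp add: dist_norm add.assoc norm_minus_commute add.commute[of "s *\<^sub>R a"])
      then show ?thesis using r by auto
    qed
    have der: "((\<lambda>s. F (x + c *\<^sub>R b + s *\<^sub>R a)) has_real_derivative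
        pd i F (x + c *\<^sub>R b + s *\<^sub>R a)) (at s)"
      if "0 \<le> s" "s \<le> h" "0 \<le> c" "c \<le> h" for s c
    proof -
      have "((\<lambda>s. x + c *\<^sub>R b + s *\<^sub>R a) has_vector_derivative a) (at s)"
        by (auto intro!: derivative_eq_intros)
      from has_real_derivative_along_curve[OF this F[OF small[OF that]]]
      show ?thesis
        by (simp add: a_def sum_axis)
    qed
    have "\<exists>z. z > 0 \<and> z < h \<and> k h - k 0 = (h - 0) *
        (pd i F (x + h *\<^sub>R b + z *\<^sub>R a) - pd i F (x + z *\<^sub>R a))"
    proof (rule MVT2)
      show "0 < h" by fact
      fix s assume "0 \<le> s" "s \<le> h"
      then show "DERIV k s :> pd i F (x + h *\<^sub>R b + s *\<^sub>R a) - pd i F (x + s *\<^sub>R a)"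
        unfolding k_def using der[of s h] der[of s 0] h by (auto intro: DERIV_diff)
    qed
    then obtain z where z: "0 < z" "z < h"
      "k h - k 0 = h * (pd i F (x + h *\<^sub>R b + z *\<^sub>R a) - pd i F (x + z *\<^sub>R a))" by auto
    have n1: "norm (h *\<^sub>R b + z *\<^sub>R a) \<le> 2 * h" "norm (z *\<^sub>R a) \<le> h"
      using nb[of z h] z na by auto
    have e1: "norm (pd i F (x + h *\<^sub>R b + z *\<^sub>R a) - pd i F x - D (h *\<^sub>R b + z *\<^sub>R a)) \<le> e/4 * (2 * h)"
      using dD[of "x + h *\<^sub>R b + z *\<^sub>R a"] n1 h \<open>e>0\<close>
      by (smt (verit) ab_semigroup_add_class.add_ac(1) add_diff_cancel_left' divide_pos_pos mult_left_mono)
    have e2: "norm (pd i F (x + z *\<^sub>R a) - pd i F x - D (z *\<^sub>R a)) \<le> e/4 * h"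
      using dD[of "x + z *\<^sub>R a"] n1 h \<open>e>0\<close>
      by (smt (verit) add_diff_cancel_left' divide_pos_pos mult_left_mono)
    \<comment> \<open>The unknown intermediate point \<open>z\<close> drops out of the linear parts:
      only \<open>D (h *\<^sub>R b)\<close> remains.\<close>
    have DD: "D (h *\<^sub>R b + z *\<^sub>R a) - D (z *\<^sub>R a) = h * pd j (pd i F) x"
      by (simp add: linear_add[OF lin] linear_scale[OF lin] pd_eqI[OF D] b_def)
    have "\<bar>pd i F (x + h *\<^sub>R b + z *\<^sub>R a) - pd i F (x + z *\<^sub>R a) - h * pd j (pd i F) x\<bar>
        \<le> e/4 * (3 * h)"
    proof -
      have "e/4 * (3 * h) = e/4 * (2 * h) + e/4 * h" by simp
      then show ?thesis using e1 e2 DD unfolding real_norm_def by linarith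
    qed
    then have "\<bar>(k h - k 0) - h^2 * pd j (pd i F) x\<bar> \<le> h * (e/4 * (3 * h))"
    proof -
      have "(k h - k 0) - h^2 * pd j (pd i F) x
          = h * (pd i F (x + h *\<^sub>R b + z *\<^sub>R a) - pd i F (x + z *\<^sub>R a) - h * pd j (pd i F) x)"
        using z(3) by (simp add: power2_eq_square right_diff_distrib)
      then show ?thesis
        using \<open>\<bar>_ - _ - _\<bar> \<le> e/4 * (3 * h)\<close> h by (simp only: abs_mult) (simp add: mult_left_mono)
    qed
    then have "\<bar>(k h - k 0) / h^2 - pd j (pd i F) x\<bar> \<le> e * 3 / 4"
      using h by (simp add: field_simps power2_eq_square abs_le_iff)
    moreover have "k h - k 0
        = F (x + h *\<^sub>R a + h *\<^sub>R b) - F (x + h *\<^sub>R a) - F (x + h *\<^sub>R b) + F x"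
      by (simp add: k_def algebra_simps)
    ultimately show ?thesis using \<open>e > 0\<close> by (simp add: dist_real_def)
  qed
  have "eventually (\<lambda>h::real. h \<in> {0<..<min d r / 2}) (at_right 0)"
    using d r by (intro eventually_at_right_real) auto
  then show "eventually (\<lambda>h. dist ((F (x + h *\<^sub>R a + h *\<^sub>R b) - F (x + h *\<^sub>R a)
      - F (x + h *\<^sub>R b) + F x) / h^2) (pd j (pd i F) x) < e) (at_right 0)"
    by eventually_elim (rule main, auto)
qed

text \<open>Young's form of the symmetry of second derivatives, which does not ask for their continuity.\<close>

lemma pd_commute:
  fixes F :: "real^'n::finite \<Rightarrow> real"
  assumes "open S" "x \<in> S" and "\<And>y. y \<in> S \<Longrightarrow> F differentiable (at y)"
    and "pd i F differentiable (at x)" "pd j F differentiable (at x)"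
  shows "pd i (pd j F) x = pd j (pd i F) x"
\<comment> \<open>Both mixed derivatives are limits of the same symmetric quotient.\<close>
proof (rule tendsto_unique[OF _ second_difference_quotient[of S x F j i]])
  show "((\<lambda>h. (F (x + h *\<^sub>R axis j 1 + h *\<^sub>R axis i 1) - F (x + h *\<^sub>R axis j 1)
      - F (x + h *\<^sub>R axis i 1) + F x) / h^2) \<longlongrightarrow> pd j (pd i F) x) (at_right 0)"
    using second_difference_quotient[of S x F i j] assms
    by (simp add: algebra_simps)
qed (use assms in auto)

section \<open>Positive definite matrices\<close>

definition posdef :: "real^'n^'n \<Rightarrow> bool" where
  "posdef A \<longleftrightarrow> transpose A = A \<and> (\<forall>v. v \<noteq> 0 \<longrightarrow> v \<bullet> (A *v v) > 0)"

lemma posdef_entry_commute: "posdef A \<Longrightarrow> A $ i $ j = A $ j $ i"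
proof -
  assume "posdef A"
  then have "A $ i $ j = transpose A $ i $ j" by (simp add: posdef_def)
  then show ?thesis by (simp add: transpose_def)
qed

lemma posdef_inner_commute:
  assumes "posdef A" shows "x \<bullet> (A *v y) = y \<bullet> (A *v x)"
  using assms unfolding posdef_def by (metis dot_lmul_matrix inner_commute transpose_matrix_vector)

lemma posdef_invertible:
  fixes A :: "real^'n::finite^'n"
  assumes "posdef A" shows "invertible A"
proof -
  have "A *v v = 0 \<Longrightarrow> v = 0" for v
    using assms unfolding posdef_def by (metis inner_zero_right less_irrefl)
  then show ?thesis
    using invertible_left_inverse matrix_left_invertible_ker by blast
qed

text \<open>The segment from the identity to \<open>A\<close> consists of positive definite, hence
  invertible matrices, so the determinant keeps along it the sign that it has at the
  identity.\<close>

lemma posdef_det_pos: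
  fixes A :: "real^'n::finite^'n"
  assumes "posdef A" shows "det A > 0"
proof (rule ccontr)
  assume neg: "\<not> det A > 0"
  define B where "B = (\<lambda>t. (1 - t) *\<^sub>R (mat 1 :: real^'n^'n) + t *\<^sub>R A)"
  have cont: "continuous_on {0..1} (\<lambda>t. det (B t))"
    unfolding det_def B_def by (intro continuous_intros)
  have B: "det (B t) \<noteq> 0" if t: "0 \<le> t" "t \<le> 1" for t
  proof -
    have "v \<bullet> (B t *v v) > 0" if "v \<noteq> 0" for v
    proof -
      have "v \<bullet> (B t *v v) = (1 - t) * (v \<bullet> v) + t * (v \<bullet> (A *v v))"
        by (simp add: B_def matrix_vector_mult_add_rdistrib inner_add_right
            flip: scaleR_matrix_vector_assoc)
      moreover have "v \<bullet> v > 0" "v \<bullet> (A *v v) > 0"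
        using that assms by (auto simp: posdef_def)
      ultimately show ?thesis
        using t by (smt (verit) mult_nonneg_nonneg mult_pos_pos)
    qed
    then have "v = 0" if "B t *v v = 0" for v
      using that by force
    then have "invertible (B t)"
      unfolding invertible_left_inverse matrix_left_invertible_ker by blast
    then show ?thesis by (simp add: invertible_det_nz)
  qed
  have "\<exists>t\<ge>0. t \<le> 1 \<and> det (B t) = 0"
    by (rule IVT2') (use neg cont in \<open>auto simp: B_def det_I\<close>)
  then show False using B by blast
qed

lemma matrix_inv_mult:
  fixes A :: "real^'n::finite^'n"
  assumes "invertible A"
  shows "matrix_inv A ** A = mat 1" "A ** matrix_inv A = mat 1"
  using someI_ex[OF assms[unfolded invertible_def]] unfolding matrix_inv_def by auto

text \<open>The quadratic form at \<open>E *\<^sub>R x - w *\<^sub>R y\<close> equals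
  \<open>E\<close> times the Cauchy--Schwarz defect. In the equality case this vector is therefore
  zero, which later forces the gradient to be tangent to the geodesic.\<close>

lemma posdef_Cauchy_Schwarz:
  fixes A :: "real^'n::finite^'n"
  assumes "posdef A"
  shows "(x \<bullet> (A *v y))\<^sup>2 \<le> (x \<bullet> (A *v x)) * (y \<bullet> (A *v y))"
    and "\<lbrakk>(x \<bullet> (A *v y))\<^sup>2 = (x \<bullet> (A *v x)) * (y \<bullet> (A *v y)); y \<noteq> 0\<rbrakk>
      \<Longrightarrow> (y \<bullet> (A *v y)) *\<^sub>R x = (x \<bullet> (A *v y)) *\<^sub>R y"
proof -
  define E where "E = y \<bullet> (A *v y)"
  define w where "w = x \<bullet> (A *v y)"
  have exp: "(E *\<^sub>R x - w *\<^sub>R y) \<bullet> (A *v (E *\<^sub>R x - w *\<^sub>R y)) = E * (E * (x \<bullet> (A *v x)) - w\<^sup>2)"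
    using posdef_inner_commute[OF assms, of x y]
    by (simp add: matrix_vector_mult_diff_distrib inner_diff_left inner_diff_right
        matrix_vector_mult_scaleR E_def w_def power2_eq_square algebra_simps)
  have E: "y \<noteq> 0 \<Longrightarrow> E > 0" using assms by (simp add: posdef_def E_def)
  have nonneg: "v \<bullet> (A *v v) \<ge> 0" for v
    using assms unfolding posdef_def by (cases "v = 0") (auto intro: less_imp_le)
  show "(x \<bullet> (A *v y))\<^sup>2 \<le> (x \<bullet> (A *v x)) * (y \<bullet> (A *v y))"
  proof (cases "y = 0")
    case False
    then have "E * (x \<bullet> (A *v x)) - w\<^sup>2 \<ge> 0"
      using exp nonneg E by (metis zero_le_mult_iff not_less)
    then show ?thesis by (simp add: E_def w_def mult.commute)
  qed simp
  assume "(x \<bullet> (A *v y))\<^sup>2 = (x \<bullet> (A *v x)) * (y \<bullet> (A *v y))" "y \<noteq> 0"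
  then have "(E *\<^sub>R x - w *\<^sub>R y) \<bullet> (A *v (E *\<^sub>R x - w *\<^sub>R y)) = 0"
    unfolding exp by (simp add: E_def w_def mult.commute)
  then have "E *\<^sub>R x - w *\<^sub>R y = 0"
    using assms unfolding posdef_def by (metis less_irrefl)
  then show "(y \<bullet> (A *v y)) *\<^sub>R x = (x \<bullet> (A *v y)) *\<^sub>R y"
    by (simp add: E_def w_def)
qed

lemma inner_matrix_vector_eq_sum:
  fixes A :: "real^'n::finite^'n"
  shows "x \<bullet> (A *v y) = (\<Sum>i\<in>UNIV. \<Sum>j\<in>UNIV. x $ i * A $ i $ j * y $ j)"
  by (simp add: inner_vec_def matrix_vector_mult_def sum_distrib_left mult.assoc)

section \<open>A metric on an open set of coordinates\<close>

lemma sum_swap3: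
  "(\<Sum>i\<in>A. \<Sum>j\<in>B. \<Sum>k\<in>C. f i j k) = (\<Sum>k\<in>C. \<Sum>j\<in>B. \<Sum>i\<in>A. f i j k)"
proof -
  have "(\<Sum>i\<in>A. \<Sum>j\<in>B. \<Sum>k\<in>C. f i j k) = (\<Sum>j\<in>B. \<Sum>i\<in>A. \<Sum>k\<in>C. f i j k)"
    by (rule sum.swap)
  also have "\<dots> = (\<Sum>j\<in>B. \<Sum>k\<in>C. \<Sum>i\<in>A. f i j k)"
    by (intro sum.cong refl sum.swap)
  also have "\<dots> = (\<Sum>k\<in>C. \<Sum>j\<in>B. \<Sum>i\<in>A. f i j k)"
    by (rule sum.swap)
  finally show ?thesis .
qed

lemma sum_swap4:
  "(\<Sum>i\<in>A. \<Sum>j\<in>B. \<Sum>k\<in>C. \<Sum>l\<in>D. f i j k l) = (\<Sum>l\<in>D. \<Sum>j\<in>B. \<Sum>k\<in>C. \<Sum>i\<in>A. f i j k l)"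
proof -
  have "(\<Sum>i\<in>A. \<Sum>j\<in>B. \<Sum>k\<in>C. \<Sum>l\<in>D. f i j k l) = (\<Sum>j\<in>B. \<Sum>i\<in>A. \<Sum>k\<in>C. \<Sum>l\<in>D. f i j k l)"
    by (rule sum.swap)
  also have "\<dots> = (\<Sum>j\<in>B. \<Sum>l\<in>D. \<Sum>k\<in>C. \<Sum>i\<in>A. f i j k l)"
    by (intro sum.cong refl sum_swap3)
  also have "\<dots> = (\<Sum>l\<in>D. \<Sum>j\<in>B. \<Sum>k\<in>C. \<Sum>i\<in>A. f i j k l)"
    by (rule sum.swap)
  finally show ?thesis .
qed

text \<open>Coordinate computations are carried out on an open set of Euclidean space; every chart
  of the manifold interprets this locale through \<open>chart_metric_gmat\<close>.\<close>

locale chart_metric =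
  fixes S :: "(real^'n::finite) set" and g :: "real^'n \<Rightarrow> real^'n^'n"
  assumes open_S: "open S" and smooth_g: "smooth_on S g"
    and posdef_g: "x \<in> S \<Longrightarrow> posdef (g x)"
begin

section \<open>Differentiability of the metric, its inverse and the Christoffel symbols\<close>

lemma g_commute: "x \<in> S \<Longrightarrow> g x $ i $ j = g x $ j $ i"
  using posdef_g posdef_entry_commute by blast

lemma ginv_g:
  assumes "x \<in> S"
  shows "matrix_inv (g x) ** g x = mat 1" "g x ** matrix_inv (g x) = mat 1"
  using matrix_inv_mult posdef_invertible posdef_g assms by blast+

lemma g_differentiable:
  assumes "x \<in> S" shows "(\<lambda>y. g y $ i $ j) differentiable (at x)"
proof -
  have "g differentiable (at x)" using smooth_onD_differentiable smooth_g assms by blast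
  then obtain D where "(g has_derivative D) (at x)" unfolding differentiable_def by blast
  then have "((\<lambda>y. g y $ i $ j) has_derivative (\<lambda>h. D h $ i $ j)) (at x)"
    by (intro bounded_linear.has_derivative[OF bounded_linear_vec_nth])
  then show ?thesis unfolding differentiable_def by blast
qed

text \<open>Smoothness is given for the matrix-valued map \<open>g\<close>; this identity carries it
  over to derivatives of single entries.\<close>

lemma pd_g:
  assumes "x \<in> S"
  shows "pd k (\<lambda>y. g y $ i $ j) x = frechet_derivative g (at x) (axis k 1) $ i $ j"
proof (rule pd_eqI)
  have "(g has_derivative frechet_derivative g (at x)) (at x)"
    using smooth_onD_differentiable smooth_g assms frechet_derivative_works by blast
  then show "((\<lambda>y. g y $ i $ j) has_derivative
      (\<lambda>h. frechet_derivative g (at x) h $ i $ j)) (at x)"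
    by (intro bounded_linear.has_derivative[OF bounded_linear_vec_nth])
qed

lemma pd_g_differentiable:
  assumes "x \<in> S" shows "pd k (\<lambda>y. g y $ i $ j) differentiable (at x)"
proof (rule differentiable_cong_on[OF open_S assms])
  show "frechet_derivative g (at y) (axis k 1) $ i $ j = pd k (\<lambda>y. g y $ i $ j) y" if "y \<in> S" for y
    using pd_g that by simp
  have "(\<lambda>y. frechet_derivative g (at y) (axis k 1)) differentiable (at x)"
    using smooth_onD_differentiable smooth_onD_frechet_derivative smooth_g assms by blast
  then obtain D where "((\<lambda>y. frechet_derivative g (at y) (axis k 1)) has_derivative D) (at x)"
    unfolding differentiable_def by blast
  then have "((\<lambda>y. frechet_derivative g (at y) (axis k 1) $ i $ j) has_derivative
      (\<lambda>h. D h $ i $ j)) (at x)"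
    by (intro bounded_linear.has_derivative[OF bounded_linear_vec_nth])
  then show "(\<lambda>y. frechet_derivative g (at y) (axis k 1) $ i $ j) differentiable (at x)"
    unfolding differentiable_def by blast
qed

lemma pd_g_commute: "x \<in> S \<Longrightarrow> pd k (\<lambda>y. g y $ i $ j) x = pd k (\<lambda>y. g y $ j $ i) x"
  by (intro pd_cong_on[OF open_S]) (auto simp: g_commute)

text \<open>Cramer's rule shows the entries of the inverse as quotients of polynomials in the
  entries of \<open>g\<close>, with nonvanishing denominator; the differentiability of the inverse
  follows.\<close>

lemma ginv_cramer:
  assumes "x \<in> S"
  shows "matrix_inv (g x) $ k $ l
    = det (\<chi> i j. if j = k then axis l 1 $ i else g x $ i $ j) / det (g x)"
proof -
  have nz: "det (g x) \<noteq> 0"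
    using posdef_det_pos posdef_g assms by (metis less_irrefl)
  have "g x *v (matrix_inv (g x) *v axis l 1) = axis l 1"
    by (simp add: matrix_vector_mul_assoc ginv_g assms)
  then have "matrix_inv (g x) *v axis l 1
      = (\<chi> k. det (\<chi> i j. if j = k then axis l 1 $ i else g x $ i $ j) / det (g x))"
    using cramer[OF nz] by blast
  moreover have "(matrix_inv (g x) *v axis l 1) $ k = matrix_inv (g x) $ k $ l"
    by (simp add: matrix_vector_mul_component inner_axis)
  ultimately show ?thesis by simp
qed

lemma ginv_differentiable:
  assumes "x \<in> S" shows "(\<lambda>y. matrix_inv (g y) $ k $ l) differentiable (at x)"
proof (rule differentiable_cong_on[OF open_S assms])
  have "det (g x) \<noteq> 0" using posdef_det_pos posdef_g assms by (metis less_irrefl)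
  moreover have "(\<lambda>y. (\<chi> i j. if j = k then axis l 1 $ i else g y $ i $ j) $ i $ j)
      differentiable (at x)" for i j
    using g_differentiable[OF assms] by (cases "j = k") auto
  ultimately show "(\<lambda>y. det (\<chi> i j. if j = k then axis l 1 $ i else g y $ i $ j) / det (g y))
      differentiable (at x)"
    using g_differentiable[OF assms] by (intro differentiable_divide det_differentiable) auto
qed (use ginv_cramer in auto)

lemma christoffel_differentiable:
  assumes "x \<in> S" shows "christoffel g k i j differentiable (at x)"
  unfolding christoffel_def
  by (intro differentiable_sumI differentiable_mult differentiable_add differentiable_diff
      ginv_differentiable pd_g_differentiable assms) auto

lemma christoffel_commute: "x \<in> S \<Longrightarrow> christoffel g k i j x = christoffel g k j i x"
  using pd_g_commute[of x] unfolding christoffel_def by (simp add: add.commute)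

section \<open>Compatibility of the connection with the metric\<close>

lemma g_ginv_entry:
  assumes "x \<in> S" shows "(\<Sum>k\<in>UNIV. g x $ i $ k * matrix_inv (g x) $ k $ j) = (if i = j then 1 else 0)"
    "(\<Sum>k\<in>UNIV. matrix_inv (g x) $ i $ k * g x $ k $ j) = (if i = j then 1 else 0)"
  using ginv_g[OF assms] unfolding matrix_matrix_mult_def mat_def by (simp_all add: vec_eq_iff)

text \<open>Lowering the upper index cancels the inverse metric and leaves the Christoffel symbols
  of the first kind.\<close>

lemma lowered_christoffel:
  assumes "x \<in> S"
  shows "(\<Sum>k\<in>UNIV. g x $ a $ k * christoffel g k i j x)
    = (pd i (\<lambda>y. g y $ j $ a) x + pd j (\<lambda>y. g y $ i $ a) x - pd a (\<lambda>y. g y $ i $ j) x) / 2"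
proof -
  define c where "c = (\<lambda>l. pd i (\<lambda>y. g y $ j $ l) x + pd j (\<lambda>y. g y $ i $ l) x - pd l (\<lambda>y. g y $ i $ j) x)"
  have "(\<Sum>k\<in>UNIV. g x $ a $ k * christoffel g k i j x)
      = (\<Sum>k\<in>UNIV. \<Sum>l\<in>UNIV. g x $ a $ k * matrix_inv (g x) $ k $ l * (c l / 2))"
    unfolding christoffel_def c_def by (simp add: sum_distrib_left mult.assoc)
  also have "\<dots> = (\<Sum>l\<in>UNIV. (\<Sum>k\<in>UNIV. g x $ a $ k * matrix_inv (g x) $ k $ l) * (c l / 2))"
    by (subst sum.swap, subst sum_distrib_right) simp
  also have "\<dots> = (\<Sum>l\<in>UNIV. if a = l then c l / 2 else 0)"
    unfolding g_ginv_entry[OF assms] by (rule sum.cong) auto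
  finally show ?thesis by (simp add: c_def)
qed

text \<open>This is \<nabla>g = 0 in coordinates: in the sum of the two lowered symbols all
  derivatives of the metric cancel except one, which occurs twice with the factor 1/2.\<close>

lemma pd_g_eq_christoffel:
  assumes "x \<in> S"
  shows "pd j (\<lambda>y. g y $ i $ a) x = (\<Sum>k\<in>UNIV. g x $ i $ k * christoffel g k j a x)
    + (\<Sum>k\<in>UNIV. g x $ a $ k * christoffel g k j i x)"
  unfolding lowered_christoffel[OF assms]
  by (simp add: pd_g_commute[OF assms, of _ a i] pd_g_commute[OF assms, of _ a j] pd_g_commute[OF assms, of _ j i] field_simps)

text \<open>The covariant derivative at \<open>x\<close> of a field along a curve with velocity
  \<open>v\<close>, where \<open>X\<close> is the value of the field and \<open>X'\<close> the
  ordinary derivative of its components.\<close>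

definition cov_along :: "real^'n \<Rightarrow> real^'n \<Rightarrow> real^'n \<Rightarrow> real^'n \<Rightarrow> real^'n" where
  "cov_along x v X X' = (\<chi> k. X' $ k + (\<Sum>i\<in>UNIV. \<Sum>j\<in>UNIV. christoffel g k i j x * v $ i * X $ j))"

text \<open>The Christoffel terms in the two covariant derivatives account exactly for the
  derivative of the metric coefficients along the curve, by
  \<open>pd_g_eq_christoffel\<close>.\<close>

lemma metric_compatible_along:
  assumes x: "\<xi> t \<in> S" "(\<xi> has_vector_derivative v) (at t)"
    and X: "(X has_vector_derivative X') (at t)" and Y: "(Y has_vector_derivative Y') (at t)"
  shows "((\<lambda>s. X s \<bullet> (g (\<xi> s) *v Y s)) has_real_derivative
     cov_along (\<xi> t) v (X t) X' \<bullet> (g (\<xi> t) *v Y t) + X t \<bullet> (g (\<xi> t) *v cov_along (\<xi> t) v (Y t) Y')) (at t)"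
proof -
  let ?G = "\<lambda>k i j. christoffel g k i j (\<xi> t)" and ?g = "g (\<xi> t)"
  have nth: "((\<lambda>s. Z s $ i) has_real_derivative Z' $ i) (at t)"
    if "(Z has_vector_derivative Z') (at t)" for Z :: "real \<Rightarrow> real^'n" and Z' i
    using bounded_linear.has_vector_derivative[OF bounded_linear_vec_nth that]
    by (simp add: has_real_derivative_iff_has_vector_derivative)
  have d: "((\<lambda>s. g (\<xi> s) $ i $ j) has_real_derivative
      (\<Sum>k\<in>UNIV. v $ k * pd k (\<lambda>y. g y $ i $ j) (\<xi> t))) (at t)" for i j
    by (rule has_real_derivative_along_curve[OF x(2) g_differentiable[OF x(1)]])
  let ?d = "\<lambda>i j. \<Sum>k\<in>UNIV. v $ k * pd k (\<lambda>y. g y $ i $ j) (\<xi> t)"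
  have "((\<lambda>s. X s \<bullet> (g (\<xi> s) *v Y s)) has_real_derivative
      (\<Sum>i\<in>UNIV. \<Sum>j\<in>UNIV. (X' $ i * ?g $ i $ j * Y t $ j
         + X t $ i * ?g $ i $ j * Y' $ j + X t $ i * ?d i j * Y t $ j))) (at t)"
    unfolding inner_matrix_vector_eq_sum
    by (intro DERIV_sum) (auto intro!: derivative_eq_intros nth[OF X] nth[OF Y] d simp: algebra_simps)
  moreover have "(\<Sum>i\<in>UNIV. \<Sum>j\<in>UNIV. X t $ i * ?d i j * Y t $ j)
      = (\<Sum>i\<in>UNIV. \<Sum>j\<in>UNIV. X t $ i * ?g $ i $ j *
            (\<Sum>a\<in>UNIV. \<Sum>b\<in>UNIV. ?G j a b * v $ a * Y t $ b))
      + (\<Sum>i\<in>UNIV. \<Sum>j\<in>UNIV. (\<Sum>a\<in>UNIV. \<Sum>b\<in>UNIV. ?G i a b * v $ a * X t $ b) * ?g $ i $ j * Y t $ j)"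
    (is "?L = ?R1 + ?R2")
  proof -
    \<comment> \<open>The derivative of the metric splits into two groups of terms, one correcting
      \<open>Y\<close> and one correcting \<open>X\<close>.\<close>
    have "?L = (\<Sum>i\<in>UNIV. \<Sum>j\<in>UNIV. \<Sum>k\<in>UNIV. \<Sum>h\<in>UNIV.
        X t $ i * v $ k * ?g $ i $ h * ?G h k j * Y t $ j)
      + (\<Sum>i\<in>UNIV. \<Sum>j\<in>UNIV. \<Sum>k\<in>UNIV. \<Sum>h\<in>UNIV.
        X t $ i * v $ k * ?g $ j $ h * ?G h k i * Y t $ j)"
      unfolding pd_g_eq_christoffel[OF x(1)]
      by (simp add: sum_distrib_left sum_distrib_right sum.distrib distrib_left distrib_right mult.assoc)
    \<comment> \<open>Exchanging the sums over \<open>j\<close> and \<open>h\<close> makes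
      \<open>h\<close> the index contracted with the metric, as in the correction of
      \<open>Y\<close>.\<close>
    also have "(\<Sum>i\<in>UNIV. \<Sum>j\<in>UNIV. \<Sum>k\<in>UNIV. \<Sum>h\<in>UNIV.
        X t $ i * v $ k * ?g $ i $ h * ?G h k j * Y t $ j)
      = (\<Sum>i\<in>UNIV. \<Sum>h\<in>UNIV. \<Sum>k\<in>UNIV. \<Sum>j\<in>UNIV.
        X t $ i * v $ k * ?g $ i $ h * ?G h k j * Y t $ j)"
      by (intro sum.cong refl sum_swap3)
    also have "\<dots> = ?R1"
      by (simp add: sum_distrib_left mult_ac)
    \<comment> \<open>Here \<open>i\<close> and \<open>h\<close> trade places; symmetry of the
      metric then gives the correction of \<open>X\<close>.\<close>
    also have "(\<Sum>i\<in>UNIV. \<Sum>j\<in>UNIV. \<Sum>k\<in>UNIV. \<Sum>h\<in>UNIV.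
        X t $ i * v $ k * ?g $ j $ h * ?G h k i * Y t $ j)
      = (\<Sum>h\<in>UNIV. \<Sum>j\<in>UNIV. \<Sum>k\<in>UNIV. \<Sum>i\<in>UNIV.
        X t $ i * v $ k * ?g $ j $ h * ?G h k i * Y t $ j)"
      by (rule sum_swap4)
    also have "\<dots> = ?R2"
      by (simp add: sum_distrib_left sum_distrib_right mult_ac g_commute[OF x(1)])
    finally show ?thesis .
  qed
  ultimately show ?thesis
    by (simp add: inner_matrix_vector_eq_sum cov_along_def sum.distrib algebra_simps)
qed

end

section \<open>Conformal gradient fields in coordinates\<close>

text \<open>\<open>U\<close> and \<open>\<phi>\<close> are the local expressions of a potential and
  of its conformal factor. Only finitely many orders of differentiability are asked for, and these
  can be verified directly for an exponential.\<close>

locale conformal_chart = chart_metric S g for S :: "(real^'n::finite) set" and g +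
  fixes U \<phi> :: "real^'n \<Rightarrow> real"
  assumes U_differentiable: "x \<in> S \<Longrightarrow> U differentiable (at x)"
    and pd_U_differentiable: "x \<in> S \<Longrightarrow> pd i U differentiable (at x)"
    and phi_differentiable: "x \<in> S \<Longrightarrow> \<phi> differentiable (at x)"
    and hessian_U: "x \<in> S \<Longrightarrow> hessian g U x $ i $ j = \<phi> x * g x $ i $ j"
begin

abbreviation V :: "real^'n \<Rightarrow> real^'n" where "V \<equiv> gradient g U"

lemma V_eq_sum: "V x $ k = (\<Sum>l\<in>UNIV. matrix_inv (g x) $ k $ l * pd l U x)"
  by (simp add: gradient_def differential_def matrix_vector_mult_def)

lemma g_V: "x \<in> S \<Longrightarrow> g x *v V x = differential U x"
  by (simp add: gradient_def matrix_vector_mul_assoc ginv_g)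

lemma lowered_V: "x \<in> S \<Longrightarrow> (\<Sum>a\<in>UNIV. g x $ i $ a * V x $ a) = pd i U x"
  using g_V[of x] by (simp add: matrix_vector_mult_def differential_def vec_eq_iff)

lemma V_differentiable: "x \<in> S \<Longrightarrow> (\<lambda>y. V y $ k) differentiable (at x)"
  unfolding V_eq_sum
  by (intro differentiable_sumI differentiable_mult ginv_differentiable pd_U_differentiable) auto

text \<open>Lowering an index commutes with covariant differentiation, so lowering
  \<open>\<nabla>V\<close> gives the Hessian \<open>\<phi> g\<close>; hence \<open>\<nabla>V\<close>
  is \<open>\<phi>\<close> times the identity.\<close>

lemma cov_deriv_V:
  assumes "x \<in> S"
  shows "pd j (\<lambda>y. V y $ k) x + (\<Sum>a\<in>UNIV. christoffel g k j a x * V x $ a) = (if k = j then \<phi> x else 0)"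
proof -
  define T where "T = (\<lambda>k. pd j (\<lambda>y. V y $ k) x + (\<Sum>a\<in>UNIV. christoffel g k j a x * V x $ a))"
  have T: "(\<Sum>k\<in>UNIV. g x $ i $ k * T k) = \<phi> x * g x $ i $ j" for i
  proof -
    have "pd j (pd i U) x = pd j (\<lambda>y. \<Sum>a\<in>UNIV. g y $ i $ a * V y $ a) x"
      by (rule pd_cong_on[OF open_S assms]) (simp add: lowered_V)
    also have "\<dots> = (\<Sum>a\<in>UNIV. pd j (\<lambda>y. g y $ i $ a * V y $ a) x)"
      using g_differentiable V_differentiable assms
      by (intro pd_sum differentiable_mult) auto
    also have "\<dots> = (\<Sum>a\<in>UNIV. g x $ i $ a * pd j (\<lambda>y. V y $ a) x + pd j (\<lambda>y. g y $ i $ a) x * V x $ a)"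
      using g_differentiable V_differentiable assms by (intro sum.cong refl pd_mult) auto
    \<comment> \<open>By metric compatibility, half of the derivative of \<open>g\<close> here
      completes the derivative of \<open>V\<close> to a covariant one, and the other half is the
      Christoffel term of the Hessian.\<close>
    finally have 1: "pd j (pd i U) x = \<dots>" .
    have 2: "(\<Sum>k\<in>UNIV. christoffel g k j i x * pd k U x)
        = (\<Sum>a\<in>UNIV. \<Sum>k\<in>UNIV. g x $ a $ k * christoffel g k j i x * V x $ a)"
      by (subst sum.swap)
        (simp add: lowered_V[OF assms, symmetric] sum_distrib_left g_commute[OF assms] mult_ac)
    have 3: "(\<Sum>a\<in>UNIV. \<Sum>k\<in>UNIV. g x $ i $ k * christoffel g k j a x * V x $ a)
       = (\<Sum>k\<in>UNIV. g x $ i $ k * (\<Sum>a\<in>UNIV. christoffel g k j a x * V x $ a))"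
      by (subst sum.swap) (simp add: sum_distrib_left mult_ac)
    have "hessian g U x $ j $ i = (\<Sum>k\<in>UNIV. g x $ i $ k * T k)"
      unfolding hessian_def T_def
      using 1 2 3 by (simp add: pd_g_eq_christoffel[OF assms] sum.distrib distrib_left distrib_right sum_distrib_right)
    then show ?thesis using hessian_U[OF assms, of j i] g_commute[OF assms, of i j] by simp
  qed
  \<comment> \<open>The index is raised again: the identity matrix is written as the inverse metric
    times the metric.\<close>
  have "T k = (\<Sum>l\<in>UNIV. (if k = l then 1 else 0) * T l)"
    by (simp add: if_distrib[of "\<lambda>c. c * _"] cong: if_cong)
  also have "\<dots> = (\<Sum>l\<in>UNIV. (\<Sum>i\<in>UNIV. matrix_inv (g x) $ k $ i * g x $ i $ l) * T l)"
    by (simp only: g_ginv_entry[OF assms])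
  also have "\<dots> = (\<Sum>i\<in>UNIV. matrix_inv (g x) $ k $ i * (\<Sum>l\<in>UNIV. g x $ i $ l * T l))"
    by (subst sum_distrib_right, subst sum.swap) (simp add: sum_distrib_left mult_ac)
  also have "\<dots> = (\<Sum>i\<in>UNIV. matrix_inv (g x) $ k $ i * (\<phi> x * g x $ i $ j))"
    by (simp only: T)
  also have "\<dots> = \<phi> x * (\<Sum>i\<in>UNIV. matrix_inv (g x) $ k $ i * g x $ i $ j)"
    by (simp add: sum_distrib_left mult_ac)
  finally show ?thesis by (simp add: g_ginv_entry[OF assms] T_def)
qed

section \<open>Curvature and Ricci tensor applied to the gradient field\<close>

lemma pd_V:
  assumes "x \<in> S"
  shows "pd j (\<lambda>y. V y $ k) x = (if k = j then \<phi> x else 0) - (\<Sum>a\<in>UNIV. christoffel g k j a x * V x $ a)"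
  using cov_deriv_V[OF assms, of j k] by simp

lemma pd_V_differentiable:
  assumes "x \<in> S" shows "pd j (\<lambda>y. V y $ k) differentiable (at x)"
proof (rule differentiable_cong_on[OF open_S assms])
  show "(\<lambda>y. (if k = j then \<phi> y else 0) - (\<Sum>a\<in>UNIV. christoffel g k j a y * V y $ a)) differentiable (at x)"
    by (cases "k = j") (auto intro!: differentiable_diff differentiable_sumI differentiable_mult
      christoffel_differentiable V_differentiable phi_differentiable differentiable_minus assms)
qed (simp add: pd_V)

text \<open>The first derivatives of \<open>V\<close> are eliminated by \<open>pd_V\<close>, so that
  only \<open>V\<close>, \<open>\<phi>\<close> and the derivative of \<open>\<phi>\<close> remain
  and the terms of the curvature become visible.\<close>

lemma pd_pd_V:
  assumes "x \<in> S"
  shows "pd l (pd j (\<lambda>y. V y $ i)) x = (if i = j then pd l \<phi> x else 0) - christoffel g i j l x * \<phi> x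
     + (\<Sum>b\<in>UNIV. (\<Sum>a\<in>UNIV. christoffel g i j a x * christoffel g a l b x) * V x $ b)
     - (\<Sum>a\<in>UNIV. pd l (christoffel g i j a) x * V x $ a)"
proof -
  have "pd l (pd j (\<lambda>y. V y $ i)) x
      = pd l (\<lambda>y. (if i = j then \<phi> y else 0) - (\<Sum>a\<in>UNIV. christoffel g i j a y * V y $ a)) x"
    by (rule pd_cong_on[OF open_S assms]) (simp add: pd_V)
  also have "\<dots> = pd l (\<lambda>y. if i = j then \<phi> y else 0) x - pd l (\<lambda>y. \<Sum>a\<in>UNIV. christoffel g i j a y * V y $ a) x"
    using phi_differentiable[OF assms] christoffel_differentiable[OF assms] V_differentiable[OF assms]
    by (intro pd_diff differentiable_sumI differentiable_mult) (cases "i = j", auto)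
  also have "pd l (\<lambda>y. if i = j then \<phi> y else 0) x = (if i = j then pd l \<phi> x else 0)"
    by simp
  also have "pd l (\<lambda>y. \<Sum>a\<in>UNIV. christoffel g i j a y * V y $ a) x
      = (\<Sum>a\<in>UNIV. pd l (\<lambda>y. christoffel g i j a y * V y $ a) x)"
    using christoffel_differentiable[OF assms] V_differentiable[OF assms]
    by (intro pd_sum differentiable_mult) auto
  also have "\<dots> = (\<Sum>a\<in>UNIV. christoffel g i j a x * pd l (\<lambda>y. V y $ a) x + pd l (christoffel g i j a) x * V x $ a)"
    using christoffel_differentiable[OF assms] V_differentiable[OF assms]
    by (intro sum.cong refl pd_mult) auto
  also have "\<dots> = (\<Sum>a\<in>UNIV. christoffel g i j a x * (if a = l then \<phi> x else 0))
     - (\<Sum>a\<in>UNIV. christoffel g i j a x * (\<Sum>b\<in>UNIV. christoffel g a l b x * V x $ b))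
     + (\<Sum>a\<in>UNIV. pd l (christoffel g i j a) x * V x $ a)"
    by (simp add: pd_V[OF assms] sum.distrib sum_subtractf right_diff_distrib)
  also have "(\<Sum>a\<in>UNIV. christoffel g i j a x * (if a = l then \<phi> x else 0)) = christoffel g i j l x * \<phi> x"
    by (simp add: if_distrib cong: if_cong)
  also have "(\<Sum>a\<in>UNIV. christoffel g i j a x * (\<Sum>b\<in>UNIV. christoffel g a l b x * V x $ b))
     = (\<Sum>b\<in>UNIV. (\<Sum>a\<in>UNIV. christoffel g i j a x * christoffel g a l b x) * V x $ b)"
    by (subst sum_distrib_left, subst sum.swap) (simp add: sum_distrib_left mult_ac)
  finally show ?thesis by simp
qed

text \<open>Mixed second derivatives of the components of \<open>V\<close> agree. In their
  difference the terms with undifferentiated \<open>\<phi>\<close> cancel by symmetry of the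
  Christoffel symbols, and the coefficients of \<open>V\<close> form the curvature.\<close>

lemma curvature_V:
  assumes "x \<in> S"
  shows "(\<Sum>k\<in>UNIV. curvature g i l j k x * V x $ k)
    = (if i = j then pd l \<phi> x else 0) - (if i = l then pd j \<phi> x else 0)"
proof -
  have "pd l (pd j (\<lambda>y. V y $ i)) x = pd j (pd l (\<lambda>y. V y $ i)) x"
    by (rule pd_commute[OF open_S assms]) (auto intro: V_differentiable pd_V_differentiable assms)
  then show ?thesis
    unfolding pd_pd_V[OF assms] curvature_def
    by (simp add: christoffel_commute[OF assms, of i l j] sum.distrib sum_subtractf algebra_simps)
qed

text \<open>In the trace of \<open>curvature_V\<close> the first term contributes once and the
  second as many times as the dimension.\<close>

lemma ricci_V:
  assumes "x \<in> S"
  shows "(ricci g x *v V x) $ j = (1 - real CARD('n)) * pd j \<phi> x"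
proof -
  have "(ricci g x *v V x) $ j = (\<Sum>k\<in>UNIV. \<Sum>i\<in>UNIV. curvature g i i j k x * V x $ k)"
    by (simp add: matrix_vector_mult_def ricci_def sum_distrib_right)
  also have "\<dots> = (\<Sum>i\<in>UNIV. (if i = j then pd i \<phi> x else 0) - pd j \<phi> x)"
    by (subst sum.swap) (simp add: curvature_V[OF assms])
  finally show ?thesis by (simp add: sum_subtractf algebra_simps)
qed

section \<open>The gradient field along curves and geodesics\<close>

lemma V_along:
  assumes x: "\<xi> t \<in> S" "(\<xi> has_vector_derivative v) (at t)"
  shows "\<exists>W. ((\<lambda>s. V (\<xi> s)) has_vector_derivative W) (at t)
           \<and> cov_along (\<xi> t) v (V (\<xi> t)) W = \<phi> (\<xi> t) *\<^sub>R v"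
proof (intro exI conjI)
  \<comment> \<open>The chain rule gives \<open>W\<close>; contracting \<open>cov_deriv_V\<close>
    with the velocity gives its covariant counterpart.\<close>
  define W where "W = (\<chi> k. \<Sum>j\<in>UNIV. v $ j * pd j (\<lambda>y. V y $ k) (\<xi> t))"
  have "((\<lambda>s. V (\<xi> s) $ k) has_real_derivative W $ k) (at t)" for k
    using has_real_derivative_along_curve[OF x(2) V_differentiable[OF x(1)]] by (simp add: W_def)
  then show "((\<lambda>s. V (\<xi> s)) has_vector_derivative W) (at t)"
    unfolding has_vector_derivative_def
    by (subst has_derivative_componentwise_within)
      (auto simp: Basis_vec_def inner_axis has_field_derivative_def mult_commute_abs)
  show "cov_along (\<xi> t) v (V (\<xi> t)) W = \<phi> (\<xi> t) *\<^sub>R v"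
  proof (simp add: vec_eq_iff, intro allI)
    fix k
    have "cov_along (\<xi> t) v (V (\<xi> t)) W $ k = (\<Sum>j\<in>UNIV. v $ j *
       (pd j (\<lambda>y. V y $ k) (\<xi> t) + (\<Sum>a\<in>UNIV. christoffel g k j a (\<xi> t) * V (\<xi> t) $ a)))"
      by (simp add: cov_along_def W_def distrib_left sum.distrib sum_distrib_left mult_ac)
    also have "\<dots> = (\<Sum>j\<in>UNIV. if k = j then v $ j * \<phi> (\<xi> t) else 0)"
      unfolding cov_deriv_V[OF x(1)] by (rule sum.cong) auto
    finally show "cov_along (\<xi> t) v (V (\<xi> t)) W $ k = \<phi> (\<xi> t) * v $ k" by simp
  qed
qed

text \<open>All three follow from the product rule \<open>metric_compatible_along\<close>, because
  the covariant derivative along the curve is zero for \<open>v\<close> and \<open>\<phi>\<close>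
  times \<open>v\<close> for \<open>V\<close>.\<close>

lemma along_geodesic:
  assumes x: "\<xi> t \<in> S" "(\<xi> has_vector_derivative v t) (at t)"
    and v: "(v has_vector_derivative
      (\<chi> k. - (\<Sum>i\<in>UNIV. \<Sum>j\<in>UNIV. christoffel g k i j (\<xi> t) * v t $ i * v t $ j))) (at t)"
  shows "((\<lambda>s. v s \<bullet> (g (\<xi> s) *v v s)) has_real_derivative 0) (at t)"
    and "((\<lambda>s. V (\<xi> s) \<bullet> (g (\<xi> s) *v v s)) has_real_derivative
           \<phi> (\<xi> t) * (v t \<bullet> (g (\<xi> t) *v v t))) (at t)"
    and "((\<lambda>s. V (\<xi> s) \<bullet> (g (\<xi> s) *v V (\<xi> s))) has_real_derivative
           2 * \<phi> (\<xi> t) * (V (\<xi> t) \<bullet> (g (\<xi> t) *v v t))) (at t)"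
proof -
  obtain W where W: "((\<lambda>s. V (\<xi> s)) has_vector_derivative W) (at t)"
      "cov_along (\<xi> t) (v t) (V (\<xi> t)) W = \<phi> (\<xi> t) *\<^sub>R v t"
    using V_along[of \<xi> t, OF x] by blast
  define v' where "v' = (\<chi> k. - (\<Sum>i\<in>UNIV. \<Sum>j\<in>UNIV. christoffel g k i j (\<xi> t) * v t $ i * v t $ j))"
  have v': "(v has_vector_derivative v') (at t)" "cov_along (\<xi> t) (v t) (v t) v' = 0"
    using v by (simp_all add: v'_def cov_along_def vec_eq_iff)
  show "((\<lambda>s. v s \<bullet> (g (\<xi> s) *v v s)) has_real_derivative 0) (at t)"
    using metric_compatible_along[of \<xi> t, OF x v'(1) v'(1)] by (simp add: v'(2))
  show "((\<lambda>s. V (\<xi> s) \<bullet> (g (\<xi> s) *v v s)) has_real_derivative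
      \<phi> (\<xi> t) * (v t \<bullet> (g (\<xi> t) *v v t))) (at t)"
    using metric_compatible_along[of \<xi> t, OF x W(1) v'(1)] by (simp add: v'(2) W(2))
  show "((\<lambda>s. V (\<xi> s) \<bullet> (g (\<xi> s) *v V (\<xi> s))) has_real_derivative
      2 * \<phi> (\<xi> t) * (V (\<xi> t) \<bullet> (g (\<xi> t) *v v t))) (at t)"
    using metric_compatible_along[of \<xi> t, OF x W(1) W(1)]
      posdef_inner_commute[OF posdef_g[OF x(1)], of "v t" "V (\<xi> t)"]
    by (simp add: W(2) matrix_vector_mult_scaleR mult.assoc)
qed

end

section \<open>Charts of a Riemannian manifold\<close>

lemma posdef_transform:
  fixes J A :: "real^'n::finite^'n"
  shows "x \<bullet> ((transpose J ** A ** J) *v y) = (J *v x) \<bullet> (A *v (J *v y))"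
  by (metis dot_lmul_matrix inner_commute matrix_vector_mul_assoc transpose_matrix_vector)

locale riem_mfd =
  fixes M :: "('a, 'n::finite) riem"
  assumes riemannian: "riemannian_manifold M"
begin

section \<open>A single chart\<close>

context
  fixes c assumes c: "c \<in> atlas M"
begin

lemma openin_chart: "openin (mtop M) (fst c)" "fst c \<subseteq> topspace (mtop M)"
  and open_cimg: "open (cimg c)"
  and chart_homeomorphic: "homeomorphic_map (subtopology (mtop M) (fst c)) (top_of_set (cimg c)) (snd c)"
  using riemannian c openin_subset
  unfolding riemannian_manifold_def smooth_atlas_def by (metis, metis, metis, metis)

lemma chart_inj: "inj_on (snd c) (fst c)"
  using homeomorphic_imp_injective_map[OF chart_homeomorphic] openin_chart
  by (simp add: inf_absorb2)

lemma cinv_chart: "p \<in> fst c \<Longrightarrow> cinv c (snd c p) = p"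
  unfolding cinv_def by (rule the_inv_into_f_f[OF chart_inj])

lemma chart_in_cimg: "p \<in> fst c \<Longrightarrow> snd c p \<in> cimg c"
  by (simp add: cimg_def)

lemma chart_cinv: "x \<in> cimg c \<Longrightarrow> snd c (cinv c x) = x"
  unfolding cinv_def cimg_def by (rule f_the_inv_into_f[OF chart_inj])

lemma cinv_in_chart: "x \<in> cimg c \<Longrightarrow> cinv c x \<in> fst c"
  unfolding cimg_def using cinv_chart by auto

lemma openin_chart_preimage:
  assumes "open W" shows "openin (mtop M) {p \<in> fst c. snd c p \<in> W}"
proof -
  have "openin (subtopology (mtop M) (fst c))
      {p \<in> topspace (subtopology (mtop M) (fst c)). snd c p \<in> cimg c \<inter> W}"
    using assms
    by (intro openin_continuous_map_preimage[OF homeomorphic_imp_continuous_map[OF chart_homeomorphic]])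
      (simp add: openin_open_Int)
  moreover have "{p \<in> topspace (subtopology (mtop M) (fst c)). snd c p \<in> cimg c \<inter> W}
      = {p \<in> fst c. snd c p \<in> W}"
    using openin_chart chart_in_cimg by auto
  ultimately show ?thesis
    using openin_chart(1) openin_trans_full by auto
qed

lemma open_chart_image:
  assumes "openin (mtop M) W" shows "open (snd c ` (W \<inter> fst c))"
proof -
  have "openin (subtopology (mtop M) (fst c)) (W \<inter> fst c)"
    using assms openin_subtopology by blast
  then have "openin (top_of_set (cimg c)) (snd c ` (W \<inter> fst c))"
    using homeomorphic_imp_open_map[OF chart_homeomorphic] by (simp add: open_map_def)
  then show ?thesis using open_cimg openin_open_eq by blast
qed

lemma cinv_preimage:
  "{x \<in> cimg c. cinv c x \<in> W} = snd c ` (W \<inter> fst c)"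
  using cinv_chart chart_cinv cinv_in_chart by (force simp: cimg_def)

lemma chart_metric_gmat: "chart_metric (cimg c) (gmat M c)"
  using riemannian c open_cimg
  unfolding riemannian_manifold_def riemannian_metric_def chart_metric_def posdef_def by blast

end

lemma chart_at:
  assumes "p \<in> topspace (mtop M)"
  shows "chart_at M p \<in> atlas M" "p \<in> fst (chart_at M p)"
proof -
  have "\<exists>c. c \<in> atlas M \<and> p \<in> fst c"
    using riemannian assms unfolding riemannian_manifold_def smooth_atlas_def by blast
  from someI_ex[OF this] show "chart_at M p \<in> atlas M" "p \<in> fst (chart_at M p)"
    by (auto simp: chart_at_def)
qed

section \<open>Change of charts\<close>

context
  fixes c d p assumes c: "c \<in> atlas M" and d: "d \<in> atlas M" and p: "p \<in> fst c" "p \<in> fst d"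
begin

lemma transition_has_derivative:
  "((snd d \<circ> cinv c) has_derivative (\<lambda>h. jacobian_at c d p *v h)) (at (snd c p))"
proof -
  have "smooth_on (snd c ` (fst c \<inter> fst d)) (snd d \<circ> cinv c)"
    using riemannian c d unfolding riemannian_manifold_def smooth_atlas_def by blast
  then have "(snd d \<circ> cinv c) differentiable (at (snd c p))"
    using smooth_onD_differentiable p by blast
  then have D: "((snd d \<circ> cinv c) has_derivative
      frechet_derivative (snd d \<circ> cinv c) (at (snd c p))) (at (snd c p))"
    using frechet_derivative_works by blast
  then have "jacobian_at c d p *v h = frechet_derivative (snd d \<circ> cinv c) (at (snd c p)) h" for h
    unfolding jacobian_at_def
    by (intro matrix_works) (simp add: linear_matrix_vector_mul_eq has_derivative_linear)
  with D show ?thesis by simp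
qed

lemma gmat_transform:
  "x \<bullet> (gmat M c (snd c p) *v y)
     = (jacobian_at c d p *v x) \<bullet> (gmat M d (snd d p) *v (jacobian_at c d p *v y))"
proof -
  have "gmat M c (snd c p) = transpose (jacobian_at c d p) ** gmat M d (snd d p) ** jacobian_at c d p"
    using riemannian c d p unfolding riemannian_manifold_def riemannian_metric_def by blast
  then show ?thesis by (simp add: posdef_transform)
qed

lemma differential_transform:
  assumes "(F \<circ> cinv d) differentiable (at (snd d p))"
  shows "v \<bullet> differential (F \<circ> cinv c) (snd c p)
    = (jacobian_at c d p *v v) \<bullet> differential (F \<circ> cinv d) (snd d p)"
proof -
  define D where "D = frechet_derivative (F \<circ> cinv d) (at (snd d p))"
  have D: "((F \<circ> cinv d) has_derivative D) (at (snd d p))"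
    using assms frechet_derivative_works D_def by blast
  have "(snd d \<circ> cinv c) (snd c p) = snd d p" using cinv_chart c p by simp
  then have 1: "((F \<circ> cinv d) \<circ> (snd d \<circ> cinv c) has_derivative D \<circ> (\<lambda>h. jacobian_at c d p *v h)) (at (snd c p))"
    using diff_chain_at[OF transition_has_derivative] D by simp
  have C: "((F \<circ> cinv c) has_derivative D \<circ> (\<lambda>h. jacobian_at c d p *v h)) (at (snd c p))"
  proof (rule has_derivative_transform_within_open[OF 1])
    show "open (snd c ` (fst d \<inter> fst c))" using open_chart_image openin_chart c d by blast
    show "snd c p \<in> snd c ` (fst d \<inter> fst c)" using p by blast
    fix x assume "x \<in> snd c ` (fst d \<inter> fst c)"
    then show "((F \<circ> cinv d) \<circ> (snd d \<circ> cinv c)) x = (F \<circ> cinv c) x"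
      by (auto simp: cinv_chart[OF c] cinv_chart[OF d])
  qed
  have eq: "v \<bullet> differential H y = L v" if "(H has_derivative L) (at y)" for H L y and v :: "real^'n"
  proof -
    have "H differentiable (at y)" using that unfolding differentiable_def by blast
    from frechet_derivative_eq_sum_pd[OF this, of v] show ?thesis
      by (simp add: inner_vec_def differential_def flip: frechet_derivative_at[OF that])
  qed
  show ?thesis using eq[OF C] eq[OF D] by simp
qed

text \<open>Metric and differential both pull back under the Jacobian, and the gradient is
  determined by its products with all vectors \<open>J v\<close>, since the Jacobian is
  onto.\<close>

lemma gradient_transform:
  assumes "(F \<circ> cinv d) differentiable (at (snd d p))"
  shows "jacobian_at c d p *v gradient (gmat M c) (F \<circ> cinv c) (snd c p)
    = gradient (gmat M d) (F \<circ> cinv d) (snd d p)"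
proof -
  let ?J = "jacobian_at c d p" and ?gd = "gmat M d (snd d p)" and ?gc = "gmat M c (snd c p)"
  let ?X = "gradient (gmat M c) (F \<circ> cinv c) (snd c p)"
  interpret C: chart_metric "cimg c" "gmat M c" using chart_metric_gmat c by blast
  interpret D: chart_metric "cimg d" "gmat M d" using chart_metric_gmat d by blast
  have x: "snd c p \<in> cimg c" "snd d p \<in> cimg d" using chart_in_cimg c d p by auto
  \<comment> \<open>Invertibility comes from the transformation law of the metric: a vector in the
    kernel would have length zero in the chart \<open>c\<close>.\<close>
  have "y = 0" if "?J *v y = 0" for y
  proof (rule ccontr)
    assume "y \<noteq> 0"
    then have "y \<bullet> (?gc *v y) > 0" using C.posdef_g[OF x(1)] by (simp add: posdef_def)
    then show False using gmat_transform[of y y] that by simp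
  qed
  then have "invertible ?J"
    unfolding invertible_left_inverse matrix_left_invertible_ker by blast
  then have surj: "\<exists>v. w = ?J *v v" for w
    by (metis matrix_inv_mult(2) matrix_vector_mul_assoc matrix_vector_mul_lid)
  have "w \<bullet> (?gd *v (?J *v ?X)) = w \<bullet> differential (F \<circ> cinv d) (snd d p)" for w
  proof -
    obtain v where "w = ?J *v v" using surj by blast
    then have "w \<bullet> (?gd *v (?J *v ?X)) = v \<bullet> (?gc *v ?X)" by (simp add: gmat_transform)
    also have "\<dots> = v \<bullet> differential (F \<circ> cinv c) (snd c p)"
      by (simp add: gradient_def matrix_vector_mul_assoc C.ginv_g[OF x(1)])
    also have "\<dots> = w \<bullet> differential (F \<circ> cinv d) (snd d p)"
      using differential_transform[OF assms] \<open>w = _\<close> by simp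
    finally show ?thesis .
  qed
  then have "?gd *v (?J *v ?X) = differential (F \<circ> cinv d) (snd d p)"
    by (rule vector_eq_ldot[THEN iffD1, rule_format])
  then have "matrix_inv ?gd *v (?gd *v (?J *v ?X)) = gradient (gmat M d) (F \<circ> cinv d) (snd d p)"
    by (simp add: gradient_def)
  moreover have "matrix_inv ?gd *v (?gd *v y) = y" for y
    by (simp add: matrix_vector_mul_assoc D.ginv_g[OF x(2)])
  ultimately show ?thesis by simp
qed

lemma velocity_transform:
  assumes "openin euclideanreal {s. \<gamma> s \<in> fst c}" "\<gamma> t = p"
    and "(snd c \<circ> \<gamma>) differentiable (at t)"
  shows "vector_derivative (snd d \<circ> \<gamma>) (at t)
    = jacobian_at c d p *v vector_derivative (snd c \<circ> \<gamma>) (at t)"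
proof -
  define v where "v = vector_derivative (snd c \<circ> \<gamma>) (at t)"
  have v: "((snd c \<circ> \<gamma>) has_derivative (\<lambda>h. h *\<^sub>R v)) (at t)"
    using assms(3) vector_derivative_works unfolding v_def has_vector_derivative_def by blast
  have "((snd d \<circ> cinv c) has_derivative (\<lambda>h. jacobian_at c d p *v h)) (at ((snd c \<circ> \<gamma>) t))"
    using transition_has_derivative assms(2) by simp
  from diff_chain_at[OF v this]
  have 1: "((snd d \<circ> cinv c) \<circ> (snd c \<circ> \<gamma>) has_derivative (\<lambda>h. h *\<^sub>R (jacobian_at c d p *v v))) (at t)"
    by (simp add: o_def matrix_vector_mult_scaleR)
  \<comment> \<open>The factorization through the transition map holds only while the curve stays in
    the domain of \<open>c\<close>, an open set of times.\<close>
  have "((snd d \<circ> \<gamma>) has_derivative (\<lambda>h. h *\<^sub>R (jacobian_at c d p *v v))) (at t)"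
    by (rule has_derivative_transform_within_open[OF 1, of "{s. \<gamma> s \<in> fst c}"])
      (use assms p c in \<open>auto simp: cinv_chart\<close>)
  then show ?thesis
    unfolding v_def[symmetric] has_vector_derivative_def[symmetric] by (rule vector_derivative_at)
qed

end

text \<open>Gradient and metric change by the same Jacobian, so the chart picked by
  \<open>chart_at\<close> may be replaced by any other.\<close>

lemma norm_grad_chart:
  assumes "c \<in> atlas M" "p \<in> fst c"
    and F: "\<And>d x. d \<in> atlas M \<Longrightarrow> x \<in> cimg d \<Longrightarrow> (F \<circ> cinv d) differentiable (at x)"
  shows "norm_grad M F p
    = metric_norm (gmat M c (snd c p)) (gradient (gmat M c) (F \<circ> cinv c) (snd c p))"
proof -
  have "p \<in> topspace (mtop M)" using assms openin_chart by blast
  note d = chart_at[OF this]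
  have "(F \<circ> cinv c) differentiable (at (snd c p))" using F assms chart_in_cimg by blast
  from gradient_transform[OF d(1) assms(1) d(2) assms(2) this]
  show ?thesis
    unfolding norm_grad_def metric_norm_def Let_def
    by (simp add: gmat_transform[OF d(1) assms(1) d(2) assms(2)])
qed

section \<open>Essential bounds of continuous functions\<close>

lemma sets_chart_volume: "sets (chart_volume M c) = sets (sigma (topspace (mtop M)) {U. openin (mtop M) U})"
  by (simp add: chart_volume_def)

text \<open>A nonempty atlas excludes the supremum of the empty family, which is the measure on the
  empty space.\<close>

lemma riem_volume_space_sets: 
  assumes "atlas M \<noteq> {}" 
  shows "sets (riem_volume M) = sets (sigma (topspace (mtop M)) {U. openin (mtop M) U})"
    "space (riem_volume M) = topspace (mtop M)"
proof -
  show "sets (riem_volume M) = sets (sigma (topspace (mtop M)) {U. openin (mtop M) U})"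
    unfolding riem_volume_def by (rule sets_SUP[OF sets_chart_volume assms])
  from sets_eq_imp_space_eq[OF this] show "space (riem_volume M) = topspace (mtop M)"
    by (simp add: space_measure_of_conv)
qed

text \<open>The chart volume lies below the full volume and has positive density, so null sets
  become Lebesgue null in coordinates.\<close>

lemma chart_volume_null_setD:
  assumes c: "c \<in> atlas M" and N: "N \<in> null_sets (riem_volume M)"
  shows "AE x in lborel. x \<in> cimg c \<longrightarrow> cinv c x \<notin> N"
proof -
  let ?\<Sigma> = "sigma (topspace (mtop M)) {U. openin (mtop M) U}"
  let ?R = "restrict_space lborel (cimg c)"
  let ?f = "\<lambda>x. ennreal (sqrt (det (gmat M c x)))"
  have ne: "atlas M \<noteq> {}" using c by blast
  interpret C: chart_metric "cimg c" "gmat M c" using chart_metric_gmat c by blast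
  have "chart_volume M c \<le> riem_volume M"
    unfolding riem_volume_def using c by (intro SUP_upper)
  \<comment> \<open>The order on measures compares values only when the sigma-algebras
    coincide.\<close>
  then have "emeasure (chart_volume M c) N \<le> emeasure (riem_volume M) N"
    using riem_volume_space_sets(1)[OF ne] by (intro le_measureD3) (simp_all add: sets_chart_volume)
  then have N': "N \<in> sets ?\<Sigma>" "emeasure (chart_volume M c) N = 0"
    using N riem_volume_space_sets(1)[OF ne] by (auto simp: null_sets_def)
  have cs: "cimg c \<in> sets borel" using open_cimg[OF c] by (rule borel_open)
  have meas: "cinv c \<in> measurable (density ?R ?f) ?\<Sigma>"
  proof (rule measurable_measure_of)
    show "{U. openin (mtop M) U} \<subseteq> Pow (topspace (mtop M))" using openin_subset by blast
    show "cinv c \<in> space (density ?R ?f) \<rightarrow> topspace (mtop M)"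
      using cinv_in_chart[OF c] openin_chart[OF c] by (auto simp: space_restrict_space)
    fix W assume "W \<in> {U. openin (mtop M) U}"
    then have "open {x \<in> cimg c. cinv c x \<in> W}"
      using open_chart_image[OF c] by (simp add: cinv_preimage[OF c])
    moreover have "cinv c -` W \<inter> cimg c = {x \<in> cimg c. cinv c x \<in> W}" by auto
    ultimately show "cinv c -` W \<inter> space (density ?R ?f) \<in> sets (density ?R ?f)"
      using cs by (simp add: space_restrict_space sets_restrict_space_iff)
  qed
  have fm: "?f \<in> borel_measurable ?R"
  proof -
    have "continuous_on (cimg c) (\<lambda>x. det (gmat M c x))"
      using det_differentiable[OF C.g_differentiable]
      by (intro continuous_at_imp_continuous_on ballI differentiable_imp_continuous_within)
    then have "continuous_on (cimg c) (\<lambda>x. sqrt (det (gmat M c x)))"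
      by (intro continuous_intros)
    then have "(\<lambda>x. sqrt (det (gmat M c x))) \<in> borel_measurable (restrict_space borel (cimg c))"
      by (rule borel_measurable_continuous_on_restrict)
    then have "(\<lambda>x. sqrt (det (gmat M c x))) \<in> borel_measurable ?R"
      by (simp cong: measurable_cong_sets add: sets_restrict_space)
    then show ?thesis by measurable
  qed
  have "emeasure (density ?R ?f) (cinv c -` N \<inter> cimg c) = 0"
    using N' emeasure_distr[OF meas N'(1)] by (simp add: chart_volume_def space_restrict_space)
  moreover have "cinv c -` N \<inter> cimg c \<in> sets ?R"
    using measurable_sets[OF meas N'(1)] by (simp add: space_restrict_space)
  ultimately have "cinv c -` N \<inter> cimg c \<in> null_sets (density ?R ?f)"
    by (simp add: null_sets_def)
  then have "AE x in ?R. x \<in> cinv c -` N \<inter> cimg c \<longrightarrow> ?f x = 0"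
    by (simp add: null_sets_density_iff[OF fm])
  then have "AE x in lborel. x \<in> cimg c \<longrightarrow> x \<in> cinv c -` N \<inter> cimg c \<longrightarrow> ?f x = 0"
    using cs by (simp add: AE_restrict_space_iff)
  then show ?thesis
  proof (rule eventually_mono, intro impI notI)
    fix x assume "x \<in> cimg c \<longrightarrow> x \<in> cinv c -` N \<inter> cimg c \<longrightarrow> ?f x = 0" "x \<in> cimg c" "cinv c x \<in> N"
    then show False using posdef_det_pos[OF C.posdef_g[of x]] by simp
  qed
qed

text \<open>By continuity, a point violating the essential bound has a whole coordinate
  neighbourhood of violations, and a nonempty open set is not Lebesgue null. So the bound holds
  everywhere.\<close>

lemma L_infinity_bounded:
  assumes h: "h \<in> L_infinity (riem_volume M)"
    and cont: "\<And>c. c \<in> atlas M \<Longrightarrow> continuous_on (cimg c) (h \<circ> cinv c)"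
  shows "\<exists>C. \<forall>p\<in>topspace (mtop M). \<bar>h p\<bar> \<le> C"
proof -
  obtain C where C: "AE p in riem_volume M. \<bar>h p\<bar> \<le> C"
    using h unfolding L_infinity_def by blast
  then obtain N where N: "{p \<in> space (riem_volume M). \<not> \<bar>h p\<bar> \<le> C} \<subseteq> N" "N \<in> null_sets (riem_volume M)"
    by (auto simp: eventually_ae_filter)
  have "\<bar>h p\<bar> \<le> C" if p: "p \<in> topspace (mtop M)" for p
  proof (rule ccontr)
    assume big: "\<not> \<bar>h p\<bar> \<le> C"
    define c where "c = chart_at M p"
    have c: "c \<in> atlas M" "p \<in> fst c" using chart_at[OF p] by (auto simp: c_def)
    have sp: "space (riem_volume M) = topspace (mtop M)"
      using riem_volume_space_sets(2) c by blast
    define W where "W = {x \<in> cimg c. C < \<bar>(h \<circ> cinv c) x\<bar>}"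
    have "W = cimg c \<inter> (\<lambda>x. \<bar>(h \<circ> cinv c) x\<bar>) -` {C<..}" by (auto simp: W_def)
    moreover have "continuous_on (cimg c) (\<lambda>x. \<bar>(h \<circ> cinv c) x\<bar>)"
      using cont[OF c(1)] by (intro continuous_intros)
    ultimately have W: "open W"
      using continuous_open_preimage[OF _ open_cimg[OF c(1)] open_greaterThan] by metis
    have "W \<subseteq> {x \<in> cimg c. cinv c x \<in> N}"
    proof
      fix x assume "x \<in> W"
      then have "x \<in> cimg c" "\<not> \<bar>h (cinv c x)\<bar> \<le> C" by (auto simp: W_def)
      then show "x \<in> {x \<in> cimg c. cinv c x \<in> N}"
        using N(1) openin_chart(2)[OF c(1)] cinv_in_chart[OF c(1)] unfolding sp by blast
    qed
    then have "AE x in lborel. x \<notin> W"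
      using chart_volume_null_setD[OF c(1) N(2)] by (auto elim!: eventually_mono)
    then have "W \<in> null_sets lborel"
      using W by (subst AE_iff_null_sets) auto
    then have "negligible W"
      by (simp add: negligible_iff_null_sets null_sets_completionI)
    moreover have "snd c p \<in> W"
      using c big by (simp add: W_def chart_in_cimg cinv_chart)
    ultimately show False using open_not_negligible[OF W] by blast
  qed
  then show ?thesis by blast
qed

end

section \<open>Conformal gradient fields along geodesics\<close>

text \<open>A convex function lies above its tangents, and a tangent with nonzero slope is unbounded
  above on the line.\<close>

lemma bounded_deriv_mono_imp_deriv_zero:
  fixes z p :: "real \<Rightarrow> real"
  assumes z: "\<And>t. (z has_real_derivative p t) (at t)" and "mono p"
    and bdd: "\<And>t. \<bar>z t\<bar> \<le> B"
  shows "p t = 0"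
proof (rule ccontr)
  assume "p t \<noteq> 0"
  \<comment> \<open>At \<open>s\<close> the tangent at \<open>t\<close> has risen by
    \<open>2 * B + 1\<close>, while two values of \<open>z\<close> differ by at most
    \<open>2 * B\<close>; \<open>s\<close> lies to the left of \<open>t\<close> when the slope is
    negative.\<close>
  define s where "s = t + (2 * B + 1) / p t"
  have "B \<ge> 0" using bdd[of 0] by linarith
  have "z s - z t \<ge> (s - t) * p t"
  proof (cases "p t > 0")
    case True
    then have "t < s" using \<open>B \<ge> 0\<close> by (simp add: s_def)
    then obtain r where "t < r" "r < s" "z s - z t = (s - t) * p r"
      using MVT2[of t s z p] z by blast
    then show ?thesis using monoD[OF \<open>mono p\<close>, of t r] by (simp add: mult_left_mono)
  next
    case False
    then have "s < t" using \<open>B \<ge> 0\<close> \<open>p t \<noteq> 0\<close> by (simp add: s_def divide_pos_neg)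
    then obtain r where r: "s < r" "r < t" "z t - z s = (t - s) * p r"
      using MVT2[of s t z p] z by blast
    then have "(t - s) * p r \<le> (t - s) * p t"
      using monoD[OF \<open>mono p\<close>, of r t] by (intro mult_left_mono) auto
    then show ?thesis using r by (simp add: algebra_simps)
  qed
  moreover have "(s - t) * p t = 2 * B + 1" using \<open>p t \<noteq> 0\<close> by (simp add: s_def)
  ultimately show False using bdd[of s] bdd[of t] by linarith
qed

text \<open>The square of a solution of \<open>w'' w \<ge> k w\<^sup>2\<close> with \<open>k > 0\<close> is convex on the whole line, hence
  constant as soon as it is bounded.\<close>

lemma bounded_solution_zero:
  fixes w \<phi> \<phi>' :: "real \<Rightarrow> real"
  assumes w: "\<And>t. (w has_real_derivative \<phi> t * e) (at t)"
    and \<phi>: "\<And>t. (\<phi> has_real_derivative \<phi>' t) (at t)"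
    and "e > 0" "\<alpha> > 0" "N \<ge> 0"
    and ineq: "\<And>t. N * (w t * \<phi>' t) \<ge> \<alpha> * (w t)\<^sup>2"
    and bdd: "\<And>t. (w t)\<^sup>2 \<le> B"
  shows "w t = 0"
proof (rule ccontr)
  assume "w t \<noteq> 0"
  have pos: "w s * \<phi>' s \<ge> 0" "w s \<noteq> 0 \<Longrightarrow> w s * \<phi>' s > 0" for s
  proof -
    show 1: "w s * \<phi>' s > 0" if "w s \<noteq> 0"
    proof -
      \<comment> \<open>For \<open>N = 0\<close>, the one-dimensional case, this is already
        contradictory.\<close>
      have "N * (w s * \<phi>' s) > 0" using ineq[of s] that \<open>\<alpha> > 0\<close>
        by (smt (verit) mult_pos_pos zero_less_power2)
      then show ?thesis using \<open>N \<ge> 0\<close> by (simp add: zero_less_mult_iff)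
    qed
    then show "w s * \<phi>' s \<ge> 0" by (cases "w s = 0") auto
  qed
  \<comment> \<open>\<open>p\<close> is the derivative of \<open>w\<^sup>2\<close>, and its own
    derivative is a sum of two nonnegative terms.\<close>
  define p where "p = (\<lambda>s. 2 * e * (w s * \<phi> s))"
  have z: "((\<lambda>s. (w s)\<^sup>2) has_real_derivative p s) (at s)" for s
    unfolding p_def by (auto intro!: derivative_eq_intros w)
  have p: "(p has_real_derivative 2 * e * (e * (\<phi> s)\<^sup>2 + w s * \<phi>' s)) (at s)" for s
    unfolding p_def by (auto intro!: derivative_eq_intros w \<phi> simp: power2_eq_square algebra_simps)
  have "mono p"
  proof (rule monoI)
    fix a b :: real assume "a \<le> b"
    then show "p a \<le> p b"
      by (rule DERIV_nonneg_imp_nondecreasing) (use p pos(1) \<open>e > 0\<close> in \<open>fastforce\<close>)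
  qed
  then have "p s = 0" for s
    by (rule bounded_deriv_mono_imp_deriv_zero[OF z]) (use bdd in simp)
  then have "p = (\<lambda>s. 0)" by blast
  \<comment> \<open>As \<open>p\<close> vanishes identically so does its derivative, although its
    second term is positive where \<open>w\<close> is nonzero.\<close>
  then have "2 * e * (e * (\<phi> t)\<^sup>2 + w t * \<phi>' t) = 0"
    using p[of t] DERIV_unique DERIV_const by metis
  then have "e * (\<phi> t)\<^sup>2 + w t * \<phi>' t = 0" using \<open>e > 0\<close> by simp
  moreover have "e * (\<phi> t)\<^sup>2 \<ge> 0" using \<open>e > 0\<close> by simp
  ultimately show False using pos(2)[OF \<open>w t \<noteq> 0\<close>] by linarith
qed

locale conformal_mfd = riem_mfd M for M :: "('a, 'n::finite) riem" +
  fixes u \<psi> :: "'a \<Rightarrow> real"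
  assumes conformal: "c \<in> atlas M \<Longrightarrow>
    conformal_chart (cimg c) (gmat M c) (u \<circ> cinv c) (\<psi> \<circ> cinv c)"
begin

section \<open>The gradient on the whole manifold\<close>

abbreviation grad :: "('a, 'n) chart \<Rightarrow> 'a \<Rightarrow> real^'n" where
  "grad c p \<equiv> gradient (gmat M c) (u \<circ> cinv c) (snd c p)"

abbreviation gm :: "('a, 'n) chart \<Rightarrow> 'a \<Rightarrow> real^'n^'n" where
  "gm c p \<equiv> gmat M c (snd c p)"

lemma u_differentiable:
  "c \<in> atlas M \<Longrightarrow> x \<in> cimg c \<Longrightarrow> (u \<circ> cinv c) differentiable (at x)"
  by (rule conformal_chart.U_differentiable[OF conformal])

lemma norm_grad_squared:
  assumes "c \<in> atlas M" "p \<in> fst c"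
  shows "(norm_grad M u p)\<^sup>2 = grad c p \<bullet> (gm c p *v grad c p)"
proof -
  interpret chart_metric "cimg c" "gmat M c" using chart_metric_gmat assms by blast
  have "posdef (gm c p)" using posdef_g chart_in_cimg assms by blast
  then have "grad c p \<bullet> (gm c p *v grad c p) \<ge> 0"
    unfolding posdef_def by (cases "grad c p = 0") (auto intro: less_imp_le)
  then show ?thesis
    by (simp add: norm_grad_chart[OF assms u_differentiable] metric_norm_def)
qed

lemma norm_grad_bounded:
  assumes "norm_grad M u \<in> L_infinity (riem_volume M)"
  shows "\<exists>C. \<forall>p\<in>topspace (mtop M). \<bar>norm_grad M u p\<bar> \<le> C"
proof (rule L_infinity_bounded[OF assms])
  fix c assume c: "c \<in> atlas M"
  interpret conformal_chart "cimg c" "gmat M c" "u \<circ> cinv c" "\<psi> \<circ> cinv c"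
    using conformal c by blast
  \<comment> \<open>In a fixed chart the norm is given by one formula, although
    \<open>norm_grad\<close> chooses its chart point by point.\<close>
  have "continuous_on (cimg c) (\<lambda>x. sqrt (\<Sum>i\<in>UNIV. \<Sum>j\<in>UNIV. V x $ i * gmat M c x $ i $ j * V x $ j))"
    by (intro continuous_on_real_sqrt continuous_on_sum continuous_on_mult
        continuous_at_imp_continuous_on ballI differentiable_imp_continuous_within
        V_differentiable g_differentiable)
  then show "continuous_on (cimg c) (norm_grad M u \<circ> cinv c)"
    by (rule continuous_on_eq)
      (simp add: norm_grad_chart[OF c cinv_in_chart[OF c] u_differentiable] chart_cinv[OF c]
        metric_norm_def inner_matrix_vector_eq_sum)
qed

section \<open>Quantities along a fixed geodesic\<close>

context
  fixes \<gamma> assumes geodesic: "geodesic_line M \<gamma>"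
begin

abbreviation vel :: "('a, 'n) chart \<Rightarrow> real \<Rightarrow> real^'n" where
  "vel c t \<equiv> vector_derivative (snd c \<circ> \<gamma>) (at t)"

lemma geodesic_in_manifold: "\<gamma> t \<in> topspace (mtop M)"
  using geodesic continuous_map_image_subset_topspace unfolding geodesic_line_def by fastforce

lemma open_geodesic_preimage:
  "c \<in> atlas M \<Longrightarrow> open {s. \<gamma> s \<in> fst c}"
  using openin_continuous_map_preimage[of euclideanreal "mtop M" \<gamma> "fst c"] geodesic openin_chart
  unfolding geodesic_line_def by simp

lemma geodesic_chart:
  assumes "c \<in> atlas M" "\<gamma> t \<in> fst c"
  shows "((snd c \<circ> \<gamma>) has_vector_derivative vel c t) (at t)"
    and "(vel c has_vector_derivative (\<chi> k. - (\<Sum>i\<in>UNIV. \<Sum>j\<in>UNIV.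
           christoffel (gmat M c) k i j ((snd c \<circ> \<gamma>) t) * vel c t $ i * vel c t $ j))) (at t)"
  using geodesic assms vector_derivative_works unfolding geodesic_line_def Let_def by blast+

text \<open>The squared speed. A geodesic need not stay in one chart, so the chart is chosen anew at
  each time; \<open>energy_slope_chart\<close> shows that the choice is immaterial.\<close>

definition energy where
  "energy t = (let c = chart_at M (\<gamma> t) in vel c t \<bullet> (gm c (\<gamma> t) *v vel c t))"

text \<open>The product of the gradient with the velocity, called \<open>w\<close> in the
  introduction; it is the derivative of \<open>u\<close> along the geodesic.\<close>

definition slope where
  "slope t = (let c = chart_at M (\<gamma> t) in grad c (\<gamma> t) \<bullet> (gm c (\<gamma> t) *v vel c t))"

lemma energy_slope_chart:
  assumes d: "d \<in> atlas M" "\<gamma> t \<in> fst d"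
  shows "energy t = vel d t \<bullet> (gm d (\<gamma> t) *v vel d t)"
    and "slope t = grad d (\<gamma> t) \<bullet> (gm d (\<gamma> t) *v vel d t)"
proof -
  define c where "c = chart_at M (\<gamma> t)"
  have c: "c \<in> atlas M" "\<gamma> t \<in> fst c"
    using chart_at geodesic_in_manifold by (auto simp: c_def)
  have J: "vel d t = jacobian_at c d (\<gamma> t) *v vel c t"
  proof (rule velocity_transform[OF c(1) d(1) c(2) d(2)])
    show "openin euclideanreal {s. \<gamma> s \<in> fst c}" using open_geodesic_preimage[OF c(1)] by simp
    show "(snd c \<circ> \<gamma>) differentiable (at t)"
      using geodesic_chart(1)[OF c] by (rule differentiableI_vector)
  qed simp
  have G: "grad d (\<gamma> t) = jacobian_at c d (\<gamma> t) *v grad c (\<gamma> t)"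
    using gradient_transform[OF c(1) d(1) c(2) d(2) u_differentiable] d chart_in_cimg by auto
  show "energy t = vel d t \<bullet> (gm d (\<gamma> t) *v vel d t)"
    "slope t = grad d (\<gamma> t) \<bullet> (gm d (\<gamma> t) *v vel d t)"
    unfolding energy_def slope_def Let_def c_def[symmetric]
    by (simp_all add: J G gmat_transform[OF c(1) d(1) c(2) d(2)])
qed

text \<open>Derivatives are local and the geodesic stays in the chart for an open set of times, so
  formulas from a single chart pass to globally defined functions.\<close>

lemma has_real_derivative_chart:
  assumes "c \<in> atlas M" "\<gamma> t \<in> fst c" "(F has_real_derivative D) (at t)"
    and "\<And>s. \<gamma> s \<in> fst c \<Longrightarrow> F s = H s"
  shows "(H has_real_derivative D) (at t)"
  by (rule has_field_derivative_transform_within_open[OF assms(3) open_geodesic_preimage[OF assms(1)]])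
    (use assms in auto)

lemma derivatives_along_geodesic:
  shows "(energy has_real_derivative 0) (at t)"
    and "(slope has_real_derivative \<psi> (\<gamma> t) * energy t) (at t)"
    and "((\<lambda>s. (norm_grad M u (\<gamma> s))\<^sup>2) has_real_derivative 2 * \<psi> (\<gamma> t) * slope t) (at t)"
proof -
  define c where "c = chart_at M (\<gamma> t)"
  have c: "c \<in> atlas M" "\<gamma> t \<in> fst c"
    using chart_at geodesic_in_manifold by (auto simp: c_def)
  interpret conformal_chart "cimg c" "gmat M c" "u \<circ> cinv c" "\<psi> \<circ> cinv c"
    using conformal c by blast
  have x: "(snd c \<circ> \<gamma>) t \<in> cimg c" using c chart_in_cimg by simp
  note D = along_geodesic[of "snd c \<circ> \<gamma>" t "vel c", OF x geodesic_chart[OF c]]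
  show "(energy has_real_derivative 0) (at t)"
    by (rule has_real_derivative_chart[OF c D(1)]) (simp add: energy_slope_chart[OF c(1)])
  show "(slope has_real_derivative \<psi> (\<gamma> t) * energy t) (at t)"
    by (rule has_real_derivative_chart[OF c])
      (use D(2) in \<open>simp_all add: energy_slope_chart[OF c(1)] cinv_chart[OF c(1)] c(2)\<close>)
  show "((\<lambda>s. (norm_grad M u (\<gamma> s))\<^sup>2) has_real_derivative 2 * \<psi> (\<gamma> t) * slope t) (at t)"
    by (rule has_real_derivative_chart[OF c])
      (use D(3) in \<open>simp_all add: energy_slope_chart[OF c(1)] norm_grad_squared[OF c(1)] cinv_chart[OF c(1)] c(2)\<close>)
qed

lemma psi_along_geodesic:
  assumes c: "c \<in> atlas M" "\<gamma> t \<in> fst c"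
  shows "((\<lambda>s. \<psi> (\<gamma> s)) has_real_derivative
    vel c t \<bullet> differential (\<psi> \<circ> cinv c) (snd c (\<gamma> t))) (at t)"
proof -
  interpret conformal_chart "cimg c" "gmat M c" "u \<circ> cinv c" "\<psi> \<circ> cinv c"
    using conformal c by blast
  have "((\<lambda>s. (\<psi> \<circ> cinv c) ((snd c \<circ> \<gamma>) s)) has_real_derivative
      vel c t \<bullet> differential (\<psi> \<circ> cinv c) (snd c (\<gamma> t))) (at t)"
    using has_real_derivative_along_curve[OF geodesic_chart(1)[OF c] phi_differentiable] c chart_in_cimg
    by (simp add: inner_vec_def differential_def o_def)
  then show ?thesis
    by (rule has_real_derivative_chart[OF c]) (simp add: cinv_chart c)
qed

lemma gradient_zero_at_start:
  assumes c: "c \<in> atlas M" "\<gamma> 0 \<in> fst c" and start: "vel c 0 = grad c (\<gamma> 0)"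
    and ric: "ricci_le M (- \<alpha>)" "\<alpha> > 0"
    and bdd: "\<And>p. p \<in> topspace (mtop M) \<Longrightarrow> \<bar>norm_grad M u p\<bar> \<le> C"
  shows "grad c (\<gamma> 0) = 0"
proof (rule ccontr)
  assume nz: "grad c (\<gamma> 0) \<noteq> 0"
  let ?G = "\<lambda>s. (norm_grad M u (\<gamma> s))\<^sup>2"
  define e where "e = energy 0"
  have "posdef (gm c (\<gamma> 0))"
    using chart_metric.posdef_g[OF chart_metric_gmat] chart_in_cimg c by blast
  then have e: "e > 0"
    using nz by (simp add: e_def energy_slope_chart[OF c] start posdef_def)
  have en: "energy t = e" for t
    using DERIV_isconst_all[of energy] derivatives_along_geodesic(1) unfolding e_def by blast
  \<comment> \<open>The Cauchy--Schwarz defect of gradient and velocity: both terms have the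
    derivative \<open>2 * \<psi> * slope * e\<close>.\<close>
  have Q: "((\<lambda>s. ?G s * e - (slope s)\<^sup>2) has_real_derivative 0) (at t)" for t
    using DERIV_diff[OF DERIV_cmult_right[OF derivatives_along_geodesic(3)[of t], of e]
        DERIV_power[OF derivatives_along_geodesic(2)[of t], of 2]]
    by (simp add: en mult_ac)
  have "?G t * e - (slope t)\<^sup>2 = ?G 0 * e - (slope 0)\<^sup>2" for t
    using DERIV_isconst_all[of "\<lambda>s. ?G s * e - (slope s)\<^sup>2"] Q by blast
  \<comment> \<open>The geodesic starts with the gradient as its velocity, so the constant defect is
    zero.\<close>
  moreover have "?G 0 = e" "slope 0 = e"
    by (simp_all add: e_def norm_grad_squared[OF c] energy_slope_chart[OF c] start)
  ultimately have Q0: "(slope t)\<^sup>2 = ?G t * e" for t by (simp add: power2_eq_square)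
  define N where "N = real CARD('n) - 1"
  have "N \<ge> 0" by (simp add: N_def Suc_le_eq flip: of_nat_Suc)
  \<comment> \<open>The inequality is checked at each time separately, in a chart depending on that
    time.\<close>
  define ch where "ch t = chart_at M (\<gamma> t)" for t
  define d\<psi> where "d\<psi> t = vel (ch t) t \<bullet> differential (\<psi> \<circ> cinv (ch t)) (snd (ch t) (\<gamma> t))" for t
  have ch: "ch t \<in> atlas M" "\<gamma> t \<in> fst (ch t)" for t
    using chart_at geodesic_in_manifold by (auto simp: ch_def)
  have "slope 0 = 0"
  proof (rule bounded_solution_zero[of slope "\<lambda>t. \<psi> (\<gamma> t)" e d\<psi> \<alpha> N "C\<^sup>2 * e"])
    show "(slope has_real_derivative \<psi> (\<gamma> t) * e) (at t)" for t
      using derivatives_along_geodesic(2)[of t] by (simp add: en)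
    show "((\<lambda>s. \<psi> (\<gamma> s)) has_real_derivative d\<psi> t) (at t)" for t
      unfolding d\<psi>_def by (rule psi_along_geodesic[OF ch])
    show "\<alpha> * (slope t)\<^sup>2 \<le> N * (slope t * d\<psi> t)" for t
    proof -
      let ?V = "grad (ch t) (\<gamma> t)" and ?v = "vel (ch t) t" and ?x = "snd (ch t) (\<gamma> t)"
      let ?g = "gm (ch t) (\<gamma> t)" and ?p = "differential (\<psi> \<circ> cinv (ch t)) (snd (ch t) (\<gamma> t))"
      interpret conformal_chart "cimg (ch t)" "gmat M (ch t)" "u \<circ> cinv (ch t)" "\<psi> \<circ> cinv (ch t)"
        using conformal ch by blast
      have x: "?x \<in> cimg (ch t)" using ch chart_in_cimg by blast
      have vv: "?v \<bullet> (?g *v ?v) = e" and Vv: "?V \<bullet> (?g *v ?v) = slope t"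
        and VV: "?V \<bullet> (?g *v ?V) = ?G t"
        using en[of t] by (simp_all add: energy_slope_chart[OF ch] norm_grad_squared[OF ch])
      have "?v \<noteq> 0" using vv e by auto
      \<comment> \<open>Equality in Cauchy--Schwarz makes the gradient a multiple of the velocity;
        this converts the Ricci bound for the gradient into one on the derivative of
        \<open>\<psi>\<close> along the geodesic.\<close>
      then have parallel: "e *\<^sub>R ?V = slope t *\<^sub>R ?v"
        using posdef_Cauchy_Schwarz(2)[OF posdef_g[OF x], of ?V ?v] Q0[of t]
        by (simp add: vv Vv VV)
      have "ricci (gmat M (ch t)) ?x *v ?V = (- N) *\<^sub>R ?p"
        by (simp add: vec_eq_iff ricci_V[OF x] differential_def N_def)
      then have "?V \<bullet> (ricci (gmat M (ch t)) ?x *v ?V) = - N * (?V \<bullet> ?p)" by simp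
      moreover have "?V \<bullet> (ricci (gmat M (ch t)) ?x *v ?V) \<le> - \<alpha> * ?G t"
        using ric(1) ch(1) x VV unfolding ricci_le_def by metis
      ultimately have "\<alpha> * ?G t \<le> N * (?V \<bullet> ?p)" by simp
      \<comment> \<open>Multiplication by \<open>e\<close> allows \<open>parallel\<close> and
        \<open>Q0\<close> to be applied without division.\<close>
      then have "e * (\<alpha> * ?G t) \<le> e * (N * (?V \<bullet> ?p))" using e by simp
      also have "\<dots> = N * ((e *\<^sub>R ?V) \<bullet> ?p)" by simp
      also have "\<dots> = N * (slope t * d\<psi> t)" unfolding parallel by (simp add: d\<psi>_def)
      finally show ?thesis by (simp add: Q0 mult_ac)
    qed
    show "(slope t)\<^sup>2 \<le> C\<^sup>2 * e" for t
    proof -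
      have "?G t \<le> C\<^sup>2" using bdd[OF geodesic_in_manifold[of t]] by (simp add: abs_le_square_iff[symmetric])
      then show ?thesis using e Q0[of t] by simp
    qed
  qed (fact+)
  then show False using \<open>slope 0 = e\<close> e by simp
qed

end

text \<open>Completeness supplies, for every point, a geodesic defined for all times whose initial
  velocity is the gradient there.\<close>

lemma gradient_zero:
  assumes "complete_riem M" "ricci_le M (- \<alpha>)" "\<alpha> > 0"
    and "norm_grad M u \<in> L_infinity (riem_volume M)"
    and c: "c \<in> atlas M" "p \<in> fst c"
  shows "grad c p = 0"
proof -
  obtain C where "\<And>p. p \<in> topspace (mtop M) \<Longrightarrow> \<bar>norm_grad M u p\<bar> \<le> C"
    using norm_grad_bounded[OF assms(4)] by blast
  moreover obtain \<gamma> where "geodesic_line M \<gamma>" "\<gamma> 0 = p"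
      "vector_derivative (snd c \<circ> \<gamma>) (at 0) = grad c p"
    using assms(1) c unfolding complete_riem_def by blast
  ultimately show ?thesis using gradient_zero_at_start[of \<gamma> c] assms by blast
qed

end


section \<open>Modified gradient conformal fields\<close>

text \<open>A vanishing derivative makes \<open>f\<close> constant on coordinate balls, so its level
  sets are open and closed.\<close>

lemma (in riem_mfd) constant_if_derivative_zero:
  assumes conn: "connected_space (mtop M)"
    and D: "\<And>c x. c \<in> atlas M \<Longrightarrow> x \<in> cimg c \<Longrightarrow> ((f \<circ> cinv c) has_derivative (\<lambda>h. 0)) (at x)"
  shows "\<exists>k :: real. \<forall>p\<in>topspace (mtop M). f p = k"
proof -
  \<comment> \<open>An arbitrary predicate \<open>P\<close> covers a level set and its complement at
    once.\<close>
  have op: "openin (mtop M) {q \<in> topspace (mtop M). P (f q)}" for P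
  proof (subst openin_subopen, intro ballI)
    fix q assume "q \<in> {q \<in> topspace (mtop M). P (f q)}"
    then have q: "q \<in> topspace (mtop M)" "P (f q)" by auto
    define c where "c = chart_at M q"
    have c: "c \<in> atlas M" "q \<in> fst c" using chart_at[OF q(1)] by (auto simp: c_def)
    then obtain r where r: "r > 0" "ball (snd c q) r \<subseteq> cimg c"
      using open_cimg chart_in_cimg open_contains_ball by blast
    define W where "W = {p \<in> fst c. snd c p \<in> ball (snd c q) r}"
    have "\<exists>k. \<forall>x\<in>ball (snd c q) r. (f \<circ> cinv c) x = k"
      using has_derivative_zero_constant[OF convex_ball, of "snd c q" r "f \<circ> cinv c"]
        D[OF c(1)] r has_derivative_at_withinI by blast
    then obtain k where k: "\<And>x. x \<in> ball (snd c q) r \<Longrightarrow> (f \<circ> cinv c) x = k" by blast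
    have "f p = k" if "p \<in> W" for p
      using k[of "snd c p"] that cinv_chart[OF c(1)] by (simp add: W_def)
    moreover have "q \<in> W" using c r by (simp add: W_def)
    moreover have "openin (mtop M) W"
      unfolding W_def using openin_chart_preimage[OF c(1) open_ball] .
    moreover have "W \<subseteq> topspace (mtop M)" using openin_chart[OF c(1)] by (auto simp: W_def)
    ultimately show "\<exists>T. openin (mtop M) T \<and> q \<in> T \<and> T \<subseteq> {q \<in> topspace (mtop M). P (f q)}"
      using q(2) by (intro exI[of _ W]) auto
  qed
  show ?thesis
  proof (cases "topspace (mtop M) = {}")
    case False
    then obtain p where p: "p \<in> topspace (mtop M)" by blast
    let ?A = "{q \<in> topspace (mtop M). f q = f p}"
    have "topspace (mtop M) - ?A = {q \<in> topspace (mtop M). f q \<noteq> f p}" by auto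
    then have "closedin (mtop M) ?A" using op[of "\<lambda>y. y \<noteq> f p"] by (auto simp: closedin_def)
    moreover have "openin (mtop M) ?A" using op[of "\<lambda>y. y = f p"] .
    ultimately have "?A = topspace (mtop M)"
      using conn p unfolding connected_space_clopen_in by blast
    then show ?thesis by blast
  qed simp
qed

lemma pd_exp:
  fixes F :: "real^'n::finite \<Rightarrow> real"
  assumes "F differentiable (at x)"
  shows "(\<lambda>y. exp (- F y / m)) differentiable (at x)"
    and "pd j (\<lambda>y. exp (- F y / m)) x = - (1/m) * exp (- F x / m) * pd j F x"
proof -
  have "(F has_derivative frechet_derivative F (at x)) (at x)"
    using assms frechet_derivative_works by blast
  then have "((\<lambda>y. exp (k * F y)) has_derivative
      (\<lambda>h. k * exp (k * F x) * frechet_derivative F (at x) h)) (at x)" for k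
    by (auto intro!: derivative_eq_intros)
  from this[of "- (1/m)"] have D: "((\<lambda>y. exp (- F y / m)) has_derivative
      (\<lambda>h. - (1/m) * exp (- F x / m) * frechet_derivative F (at x) h)) (at x)"
    by simp
  then show "(\<lambda>y. exp (- F y / m)) differentiable (at x)"
    unfolding differentiable_def by blast
  show "pd j (\<lambda>y. exp (- F y / m)) x = - (1/m) * exp (- F x / m) * pd j F x"
    using pd_eqI[OF D] by (simp add: pd_def)
qed

text \<open>Twice differentiating the exponential gives \<open>- (1/m) * exp (- F / m)\<close> times
  the modified Hessian of \<open>F\<close>: the substitution absorbs the quadratic term in the
  differential.\<close>

lemma conformal_chart_exp:
  fixes S :: "(real^'n::finite) set"
  assumes "chart_metric S g" and F: "smooth_on S F" and \<sigma>: "smooth_on S \<sigma>"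
    and hess: "\<And>x i j. x \<in> S \<Longrightarrow> hessian g F x $ i $ j
        - (1/m) * (differential F x $ i * differential F x $ j) = \<sigma> x * g x $ i $ j"
  shows "conformal_chart S g (\<lambda>x. exp (- F x / m)) (\<lambda>x. - exp (- F x / m) * \<sigma> x / m)"
proof -
  interpret chart_metric S g by fact
  let ?U = "\<lambda>x. exp (- F x / m)"
  have Fd: "F differentiable (at x)" and Fdd: "pd i F differentiable (at x)"
    and sd: "\<sigma> differentiable (at x)" if "x \<in> S" for x i
    using smooth_onD_differentiable smooth_onD_frechet_derivative F \<sigma> that
    unfolding pd_def[abs_def] by blast+
  have U: "?U differentiable (at x)" "pd j ?U x = (- (1/m) * ?U x) * pd j F x" if "x \<in> S" for x j
    using pd_exp[OF Fd[OF that]] by auto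
  have Um: "(\<lambda>y. - (1/m) * ?U y) differentiable (at x)" if "x \<in> S" for x
    using U(1)[OF that] by (intro differentiable_mult) auto
  show ?thesis
  proof unfold_locales
    fix x i j assume x: "x \<in> S"
    show "?U differentiable (at x)" using U(1) x .
    show "pd i ?U differentiable (at x)"
    proof (rule differentiable_cong_on[OF open_S x])
      show "(\<lambda>y. (- (1/m) * ?U y) * pd i F y) differentiable (at x)"
        by (rule differentiable_mult[OF Um[OF x] Fdd[OF x]])
    qed (use U(2) in simp)
    \<comment> \<open>At \<open>m = 0\<close> the quotient has the default value 0 and is
      constant.\<close>
    show "(\<lambda>x. - ?U x * \<sigma> x / m) differentiable (at x)"
      using U(1)[OF x] sd[OF x] by (cases "m = 0") (auto intro!: differentiable_divide differentiable_mult)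
    have "pd i (pd j ?U) x = pd i (\<lambda>y. (- (1/m) * ?U y) * pd j F y) x"
      by (rule pd_cong_on[OF open_S x]) (use U(2) in simp)
    also have "\<dots> = (- (1/m) * ?U x) * pd i (pd j F) x + pd i (\<lambda>y. - (1/m) * ?U y) x * pd j F x"
      by (rule pd_mult[OF Um[OF x] Fdd[OF x]])
    also have "pd i (\<lambda>y. - (1/m) * ?U y) x = - (1/m) * pd i ?U x"
      using pd_mult[OF _ U(1)[OF x], of "\<lambda>_. - (1/m)" i] by simp
    finally have "hessian g ?U x $ i $ j
        = (- (1/m) * ?U x) * pd i (pd j F) x - (1/m) * (- (1/m) * ?U x * pd i F x) * pd j F x
          - (\<Sum>k\<in>UNIV. christoffel g k i j x * (- (1/m) * ?U x * pd k F x))"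
      by (simp only: hessian_def vec_lambda_beta U(2)[OF x] minus_mult_left[symmetric] diff_conv_add_uminus)
    also have "\<dots> = - (1/m) * ?U x * (hessian g F x $ i $ j
        - (1/m) * (differential F x $ i * differential F x $ j))"
      by (simp add: hessian_def differential_def sum_distrib_left sum_negf algebra_simps)
    finally have "hessian g ?U x $ i $ j = - (1/m) * ?U x * (hessian g F x $ i $ j
        - (1/m) * (differential F x $ i * differential F x $ j))" .
    then show "hessian g ?U x $ i $ j = - ?U x * \<sigma> x / m * g x $ i $ j"
      unfolding hess[OF x] by simp
  qed
qed

theorem theorem3p2:
  fixes M :: "('a, 'n::finite) riem"
    and orient :: "('a, 'n) chart set"
    and m \<alpha> :: real
    and f u :: "'a \<Rightarrow> real"
  assumes "riemannian_manifold M"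
    and "connected_space (mtop M)"
    and "orientation M orient"
    and "complete_riem M"
    and "\<not> compact_space (mtop M)"
    and "0 < m"
    and "modified_gradient_conformal M m f"
    and "u = (\<lambda>p. exp (- f p / m))"
    and "0 < \<alpha>"
    and "ricci_le M (- \<alpha>)"
    and "polynomial_volume_growth M"
    and "norm_grad M u \<in> L_infinity (riem_volume M)"
    and "norm_cov_grad M u \<in> L_infinity (riem_volume M)"
  shows "\<exists>k. \<forall>p\<in>topspace (mtop M). f p = k"
proof -
  interpret riem_mfd M by unfold_locales fact
  obtain \<sigma> where f: "smooth_function M f" and \<sigma>: "smooth_function M \<sigma>"
    and hess: "\<And>c x i j. c \<in> atlas M \<Longrightarrow> x \<in> cimg c \<Longrightarrow>
      hessian (gmat M c) (f \<circ> cinv c) x $ i $ j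
        - (1/m) * (differential (f \<circ> cinv c) x $ i * differential (f \<circ> cinv c) x $ j)
      = \<sigma> (cinv c x) * gmat M c x $ i $ j"
    using assms(7) unfolding modified_gradient_conformal_def by blast
  \<comment> \<open>The conformal factor of \<open>u\<close> is the one produced by
    \<open>conformal_chart_exp\<close>.\<close>
  interpret conformal_mfd M u "\<lambda>p. - u p * \<sigma> p / m"
  proof (rule conformal_mfd.intro[OF _ conformal_mfd_axioms.intro])
    show "riem_mfd M" by unfold_locales
    fix c assume c: "c \<in> atlas M"
    have "conformal_chart (cimg c) (gmat M c) (\<lambda>x. exp (- (f \<circ> cinv c) x / m))
        (\<lambda>x. - exp (- (f \<circ> cinv c) x / m) * (\<sigma> \<circ> cinv c) x / m)"
    proof (rule conformal_chart_exp[where F = "f \<circ> cinv c" and \<sigma> = "\<sigma> \<circ> cinv c", OF chart_metric_gmat[OF c]])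
      show "smooth_on (cimg c) (f \<circ> cinv c)" "smooth_on (cimg c) (\<sigma> \<circ> cinv c)"
        using f \<sigma> c unfolding smooth_function_def by blast+
    qed (simp only: hess[OF c] comp_apply[of \<sigma>])
    then show "conformal_chart (cimg c) (gmat M c) (u \<circ> cinv c) ((\<lambda>p. - u p * \<sigma> p / m) \<circ> cinv c)"
      by (simp add: assms(8) o_def)
  qed
  show ?thesis
  proof (rule constant_if_derivative_zero[OF assms(2)])
    fix c x assume c: "c \<in> atlas M" and x: "x \<in> cimg c"
    interpret C: conformal_chart "cimg c" "gmat M c" "u \<circ> cinv c" "(\<lambda>p. - u p * \<sigma> p / m) \<circ> cinv c"
      using conformal c by blast
    let ?F = "f \<circ> cinv c"
    have F: "?F differentiable (at x)"
      using f c x smooth_onD_differentiable unfolding smooth_function_def by blast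
    have "gradient (gmat M c) (u \<circ> cinv c) x = 0"
      using gradient_zero[OF assms(4,10,9,12) c cinv_in_chart[OF c x]] chart_cinv[OF c x] by simp
    then have "differential (u \<circ> cinv c) x = 0" using C.g_V[OF x] by simp
    then have "pd j (u \<circ> cinv c) x = 0" for j by (simp add: differential_def vec_eq_iff)
    \<comment> \<open>The differential of \<open>u\<close> is \<open>- u / m\<close> times that of
      \<open>f\<close>, a nonzero factor since the exponential is positive.\<close>
    then have "pd j ?F x = 0" for j
      using pd_exp(2)[OF F, of j m] \<open>0 < m\<close> by (simp add: assms(8) o_def)
    then have "frechet_derivative ?F (at x) = (\<lambda>h. 0)"
      using frechet_derivative_eq_sum_pd[OF F] by auto
    then show "(?F has_derivative (\<lambda>h. 0)) (at x)"
      using F frechet_derivative_works by metis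
  qed
qed

end
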